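(* Let $n\geq 1$ and let $A$ and $B$ be two $n\times n$ generalized tournament matrices. The following assertions are equivalent: (i) $A$ and $B$ have the same principal minors of orders at most $4$ (i.e. $\det A[X]=\det B[X]$ for every $X\subseteq[n]$ with $1\le |X|\le 4$); (ii) $A$ and $B$ have the same principal minors of every order (i.e. $\det A[X]=\det B[X]$ for every nonempty $X\subseteq [n]$); (iii) there exists a sequence $A_0=A, A_1,\ldots,A_m=B$ of $n\times n$ generalized tournament matrices such that for each $k=0,\ldots,m-1$, $A_{k+1}=\mathrm{Inv}(A_k,X_k)$ where $X_k$ is a clan of $A_k$.
   Context: A generalized tournament matrix of order $n$ is a real $n\times n$ matrix $M=(m_{ij})$ with nonnegative entries satisfying $M+M^{t}=J_n-I_n$, where $J_n$ is the all-ones matrix and $I_n$ the identity matrix (so $m_{ii}=0$ and $m_{ij}=1-m_{ji}\in[0,1]$ for $i\neq j$). Write $[n]=\{1,\ldots,n\}$. For nonempty $X\subseteq[n]$, $M[X]$ is the principal submatrix with rows and columns indexed by $X$. A clan of $M$ is a subset $X\subseteq[n]$ such that for all $i,j\in X$ and $k\in[n]\setminus X$, $m_{ik}=m_{jk}$ and $m_{ki}=m_{kj}$. For $Y\subseteq[n]$, $\mathrm{Inv}(M,Y)$ denotes the matrix obtained from $M$ by replacing the entry $m_{ij}$ by $m_{ji}$ for all $i,j\in Y$. *)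

theory Defs
  imports "Jordan_Normal_Form.Determinant" "Jordan_Normal_Form.DL_Submatrix"
begin

text \<open>Indices are 0-based: the index set [n] = {1..n} of the paper is rendered as {..<n}.\<close>

definition gen_tournament :: "nat \<Rightarrow> real mat \<Rightarrow> bool" where
  "gen_tournament n M \<longleftrightarrow>
     M \<in> carrier_mat n n \<and>
     (\<forall>i<n. \<forall>j<n. M $$ (i,j) \<ge> 0) \<and>
     M + transpose_mat M = mat n n (\<lambda>_. 1) - 1\<^sub>m n"

definition principal_submatrix :: "'a mat \<Rightarrow> nat set \<Rightarrow> 'a mat" where
  "principal_submatrix M X = submatrix M X X"

definition is_clan :: "nat \<Rightarrow> 'a mat \<Rightarrow> nat set \<Rightarrow> bool" where
  "is_clan n M X \<longleftrightarrow> X \<subseteq> {..<n} \<and>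
     (\<forall>i\<in>X. \<forall>j\<in>X. \<forall>k\<in>{..<n} - X.
        M $$ (i,k) = M $$ (j,k) \<and> M $$ (k,i) = M $$ (k,j))"

definition Inv :: "'a mat \<Rightarrow> nat set \<Rightarrow> 'a mat" where
  "Inv M Y = mat (dim_row M) (dim_col M)
     (\<lambda>(i,j). if i \<in> Y \<and> j \<in> Y then M $$ (j,i) else M $$ (i,j))"

end

theory Submission
  imports Defs "Jordan_Normal_Form.Char_Poly"
begin

text \<open>
  A clan \<open>X\<close> of \<open>M\<close> has constant rows and columns towards each outside index, so eliminating the
  block outside \<open>X\<close> subtracts a symmetric matrix from \<open>M[X]\<close> (a Schur complement). Transposing
  \<open>M[X]\<close> therefore transposes the Schur complement, and inverting a clan preserves all principal
  minors.

  Conversely let \<open>s\<close> and \<open>t\<close> be the skew parts of two matrices with equal minors of order at most 4.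
  They agree up to signs, so every pair with nonzero entry is either kept or reversed. If in a
  triangle exactly one pair is reversed, then its two ends look the same from the third vertex.
  Consequently the components of the graph of reversed pairs are clans, and so are those of the
  graph of kept pairs. If both graphs are connected, then the vertex set has a cut: it splits into
  two nonempty parts with a constant nonzero entry from one to the other. This goes by induction,
  deleting a vertex: if a deletion disconnects one of the graphs, a cut is found directly (this is
  where the minors of order 4 enter); otherwise all vertex-deleted subsets have cuts, with the same
  constant up to sign, and Moon's theorem on strong tournaments gives a cut of the whole set.
  So a matrix without nontrivial clans can only be kept or transposed as a whole.
  If there are nontrivial clans, take a maximal one \<open>X\<close> over all matrices reachable by inversions.
  By induction one may assume that the two matrices agree on \<open>X\<close> and on the quotient by \<open>X\<close>.
  Maximality then forces the set of reversed pairs to be of the form \<open>Z \<times> (V - X)\<close> with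
  \<open>Z \<subseteq> X\<close>, and three further clan inversions remove it.
\<close>

section \<open>Connectedness and cuts\<close>

text \<open>For symmetric \<open>G\<close> this is connectedness, for arbitrary \<open>G\<close> strong connectedness.\<close>

definition connected_on :: "'a set \<Rightarrow> ('a \<Rightarrow> 'a \<Rightarrow> bool) \<Rightarrow> bool" where
  "connected_on V G \<longleftrightarrow> (\<forall>P\<subset>V. P \<noteq> {} \<longrightarrow> (\<exists>p\<in>P. \<exists>q\<in>V - P. G p q))"

lemma connected_onE:
  assumes "connected_on V G" "P \<subset> V" "P \<noteq> {}"
  obtains p q where "p \<in> P" "q \<in> V - P" "G p q"
  using assms unfolding connected_on_def by blast

lemma connected_on_neighbour:
  assumes "connected_on V G" "k \<in> V" "V - {k} \<noteq> {}"
  obtains q where "q \<in> V - {k}" "G k q"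
proof -
  have "{k} \<subset> V" "{k} \<noteq> {}" using assms(2,3) by blast+
  then obtain p q where "p \<in> {k}" "q \<in> V - {k}" "G p q" by (rule connected_onE[OF assms(1)])
  then show thesis using that by blast
qed

lemma connected_on_insert:
  assumes S: "connected_on S G" and in_edge: "u \<in> S" "G u x" and out_edge: "v \<in> S" "G x v"
  shows "connected_on (insert x S) G"
  unfolding connected_on_def
proof (intro allI impI)
  fix P assume P: "P \<subset> insert x S" "P \<noteq> {}"
  consider (disjoint) "P \<inter> S = {}" | (superset) "S \<subseteq> P" | (split) "P \<inter> S \<noteq> {}" "P \<inter> S \<subset> S" by blast
  then show "\<exists>p\<in>P. \<exists>q\<in>insert x S - P. G p q"
  proof cases
    case disjoint
    then have "P = {x}" using P by blast
    then show ?thesis using disjoint out_edge by blast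
  next
    case superset
    then have "x \<notin> P" using P by blast
    then show ?thesis using superset in_edge by blast
  next
    case split
    then obtain p q where "p \<in> P \<inter> S" "q \<in> S - P \<inter> S" "G p q"
      using connected_onE[OF S, of "P \<inter> S"] by metis
    then show ?thesis by blast
  qed
qed

lemma connected_on_insert_insert:
  assumes "S \<noteq> {}" "G p q" and S: "\<And>u. u \<in> S \<Longrightarrow> G u p" "\<And>u. u \<in> S \<Longrightarrow> G q u"
  shows "connected_on (insert p (insert q S)) G"
  unfolding connected_on_def
proof (intro allI impI)
  fix P assume P: "P \<subset> insert p (insert q S)" "P \<noteq> {}"
  consider (only_p) "p \<in> P" "q \<notin> P" | (both) "p \<in> P" "q \<in> P"
    | (meets_S) u where "p \<notin> P" "u \<in> P \<inter> S" | (only_q) "p \<notin> P" "P \<inter> S = {}" by blast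
  then show "\<exists>a\<in>P. \<exists>b\<in>insert p (insert q S) - P. G a b"
  proof cases
    case only_p
    then show ?thesis using assms(2) by blast
  next
    case both
    then obtain u where "u \<in> S - P" using P by blast
    then show ?thesis using both S(2) by blast
  next
    case meets_S
    then show ?thesis using S(1) by blast
  next
    case only_q
    then have "P = {q}" using P by blast
    moreover obtain u where "u \<in> S - P" using only_q assms(1) by blast
    ultimately show ?thesis using S(2) by blast
  qed
qed

lemma connected_on_constant:
  assumes "connected_on C G" and edge: "\<And>p q. p \<in> C \<Longrightarrow> q \<in> C \<Longrightarrow> G p q \<Longrightarrow> f p = f q"
    and "x \<in> C" "y \<in> C"
  shows "f x = f y"
proof (rule ccontr)
  assume "f x \<noteq> f y"
  then have "{p \<in> C. f p = f x} \<subset> C" "{p \<in> C. f p = f x} \<noteq> {}" using assms(3,4) by force+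
  then obtain p q where "p \<in> {p \<in> C. f p = f x}" "q \<in> C - {p \<in> C. f p = f x}" "G p q"
    by (rule connected_onE[OF assms(1)])
  then show False using edge[of p q] by auto
qed

lemma connected_component_exists:
  assumes "finite V" and sym: "symp_on V G" and "x \<in> V"
  obtains C where "x \<in> C" "C \<subseteq> V" "connected_on C G" "\<And>c y. c \<in> C \<Longrightarrow> y \<in> V - C \<Longrightarrow> \<not> G c y"
proof -
  let ?F = "{C. x \<in> C \<and> C \<subseteq> V \<and> connected_on C G}"
  have "{x} \<in> ?F" using assms(3) unfolding connected_on_def by blast
  moreover have "finite ?F" using assms(1) by (auto intro: finite_subset[of _ "Pow V"])
  ultimately obtain C where C: "C \<in> ?F" and maximal: "\<forall>C'\<in>?F. C \<subseteq> C' \<longrightarrow> C = C'"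
    using finite_has_maximal[of ?F] by blast
  have "\<not> G c y" if cy: "c \<in> C" "y \<in> V - C" for c y
  proof
    assume "G c y"
    then have "connected_on (insert y C) G"
      using connected_on_insert[of C G c y c] symp_onD[OF sym, of c y] cy C by blast
    then have "insert y C \<in> ?F" using cy C by blast
    then show False using maximal cy(2) by blast
  qed
  then show thesis using that C by blast
qed

lemma maximal_proper_connected_subset_exists:
  assumes "finite V" "2 \<le> card V"
  obtains S where "S \<noteq> {}" "S \<subset> V" "connected_on S G"
    "\<And>T. S \<subset> T \<Longrightarrow> T \<subseteq> V \<Longrightarrow> connected_on T G \<Longrightarrow> T = V"
proof -
  let ?F = "{S. S \<noteq> {} \<and> S \<subset> V \<and> connected_on S G}"
  obtain v where "v \<in> V" using assms(2) by fastforce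
  moreover have "V \<noteq> {v}" using assms(2) by auto
  ultimately have "{v} \<in> ?F" unfolding connected_on_def by blast
  moreover have "finite ?F" using assms(1) by (auto intro: finite_subset[of _ "Pow V"])
  ultimately obtain S where S: "S \<in> ?F" and maximal: "\<forall>T\<in>?F. S \<subseteq> T \<longrightarrow> S = T"
    using finite_has_maximal[of ?F] by (metis (no_types, lifting) empty_iff)
  have "T = V" if "S \<subset> T" "T \<subseteq> V" "connected_on T G" for T
    using maximal that by blast
  then show thesis using that[of S] S by blast
qed

lemma edge_from_dominated_to_dominating:
  assumes total: "totalp_on V G" and V: "connected_on V G" and S: "S \<noteq> {}" "S \<subset> V"
    and one_way: "\<And>x. x \<in> V - S \<Longrightarrow> (\<forall>u\<in>S. \<not> G x u) \<or> (\<forall>u\<in>S. \<not> G u x)"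
  obtains p q where "p \<in> V - S" "q \<in> V - S" "G p q" "\<forall>u\<in>S. G u p \<and> \<not> G p u \<and> G q u"
proof -
  define P where "P = {x \<in> V - S. \<forall>u\<in>S. \<not> G x u}"
  define Q where "Q = {x \<in> V - S. \<forall>u\<in>S. \<not> G u x}"
  have V_minus_S: "V - S = P \<union> Q" using one_way unfolding P_def Q_def by blast
  have "Q \<noteq> {}"
  proof
    assume "Q = {}"
    then have "V - S = P" "P \<subset> V" "P \<noteq> {}" using V_minus_S S by blast+
    from this(2,3) obtain p q where "p \<in> P" "q \<in> V - P" "G p q" by (rule connected_onE[OF V])
    then show False using \<open>V - S = P\<close> unfolding P_def by blast
  qed
  then have "V - Q \<subset> V" "V - Q \<noteq> {}" using S unfolding Q_def by blast+
  then obtain p q where "p \<in> V - Q" "q \<in> V - (V - Q)" "G p q" by (rule connected_onE[OF V])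
  then have pq: "p \<in> P" "q \<in> Q" "G p q" using V_minus_S unfolding Q_def by blast+
  have "G u p \<and> \<not> G p u \<and> G q u" if "u \<in> S" for u
    using totalp_onD[OF total, of u p] totalp_onD[OF total, of u q] pq that S(2)
    unfolding P_def Q_def by blast
  then show thesis using that[of p q] pq unfolding P_def Q_def by blast
qed

text \<open>Moon's theorem on strong tournaments, for semicomplete digraphs.\<close>

theorem connected_on_delete_vertex:
  assumes fin: "finite V" and card: "4 \<le> card V"
    and total: "totalp_on V G" and V: "connected_on V G"
  shows "\<exists>k\<in>V. connected_on (V - {k}) G"
proof -
  have "2 \<le> card V" using card by simp
  then obtain S where S: "S \<noteq> {}" "S \<subset> V" "connected_on S G"
    and maximal: "\<And>T. S \<subset> T \<Longrightarrow> T \<subseteq> V \<Longrightarrow> connected_on T G \<Longrightarrow> T = V"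
    using maximal_proper_connected_subset_exists[OF fin] by metis
  show ?thesis
  proof (cases "\<exists>x\<in>V - S. (\<exists>u\<in>S. G x u) \<and> (\<exists>u\<in>S. G u x)")
    case True
    then obtain x u v where x: "x \<in> V - S" "u \<in> S" "G u x" "v \<in> S" "G x v" by blast
    then have "insert x S = V"
      using maximal[of "insert x S"] connected_on_insert[OF S(3)] S(2) by blast
    then have "V - {x} = S" using x by blast
    then have "connected_on (V - {x}) G" using S(3) by simp
    then show ?thesis using x(1) by blast
  next
    case False
    then have "(\<forall>u\<in>S. \<not> G x u) \<or> (\<forall>u\<in>S. \<not> G u x)" if "x \<in> V - S" for x
      using that by blast
    then obtain p q where pq: "p \<in> V - S" "q \<in> V - S" "G p q"
      and S_edges: "\<forall>u\<in>S. G u p \<and> \<not> G p u \<and> G q u"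
      by (rule edge_from_dominated_to_dominating[OF total V S(1,2)])
    have connected: "connected_on (insert p (insert q T)) G" if "T \<subseteq> S" "T \<noteq> {}" for T
      using connected_on_insert_insert[of T G p q] that pq(3) S_edges by blast
    have V_eq: "V = insert p (insert q S)"
      using maximal[of "insert p (insert q S)"] connected[of S] S(1,2) pq(1,2) by blast
    obtain k where k: "k \<in> S" using S(1) by blast
    have "p \<noteq> q" using S_edges k by blast
    then have "S \<noteq> {k}" using card pq unfolding V_eq by auto
    moreover have "V - {k} = insert p (insert q (S - {k}))"
      using k pq(1,2) V_eq by blast
    ultimately have "connected_on (V - {k}) G" using connected[of "S - {k}"] k by auto
    then show ?thesis using k S(2) by blast
  qed
qed

definition has_cut :: "'a set \<Rightarrow> ('a \<Rightarrow> 'a \<Rightarrow> 'b) \<Rightarrow> 'b \<Rightarrow> bool" where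
  "has_cut V f a \<longleftrightarrow> \<not> connected_on V (\<lambda>i j. f i j \<noteq> a)"

lemma has_cutI:
  assumes "P \<subset> V" "P \<noteq> {}" "\<And>p q. p \<in> P \<Longrightarrow> q \<in> V - P \<Longrightarrow> f p q = a"
  shows "has_cut V f a"
  using assms unfolding has_cut_def connected_on_def by blast

lemma has_cutE:
  assumes "has_cut V f a"
  obtains P where "P \<subset> V" "P \<noteq> {}" "\<forall>p\<in>P. \<forall>q\<in>V - P. f p q = a"
  using assms unfolding has_cut_def connected_on_def by blast

lemma has_cut_unique:
  assumes sym: "\<And>i j. i \<in> V \<Longrightarrow> j \<in> V \<Longrightarrow> f j i = f i j" and "has_cut V f a" "has_cut V f b"
  shows "a = b"
proof -
  obtain P where P: "P \<subset> V" "P \<noteq> {}" "\<forall>p\<in>P. \<forall>q\<in>V - P. f p q = a"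
    using assms(2) by (rule has_cutE)
  obtain R where R: "R \<subset> V" "R \<noteq> {}" "\<forall>p\<in>R. \<forall>q\<in>V - R. f p q = b"
    using assms(3) by (rule has_cutE)
  have "P \<inter> R \<noteq> {} \<and> V - P - R \<noteq> {} \<or> P - R \<noteq> {} \<and> R - P \<noteq> {}"
    using P(1,2) R(1,2) by blast
  then consider (same_side) p q where "p \<in> P \<inter> R" "q \<in> V - P - R"
    | (opposite_sides) p q where "p \<in> P - R" "q \<in> R - P"
    by blast
  then show ?thesis
  proof cases
    case (same_side p q)
    then have "f p q = a" "f p q = b" using P(3) R(3) by blast+
    then show ?thesis by simp
  next
    case (opposite_sides p q)
    then have "f p q = a" "f q p = b" "f q p = f p q" using P(1,3) R(1,3) sym[of p q] by blast+
    then show ?thesis by simp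
  qed
qed

section \<open>Pairs of skew functions with the same small minors\<close>

definition skew_on :: "'a set \<Rightarrow> ('a \<Rightarrow> 'a \<Rightarrow> 'b :: ab_group_add) \<Rightarrow> bool" where
  "skew_on V s \<longleftrightarrow> (\<forall>i\<in>V. \<forall>j\<in>V. s j i = - s i j)"

definition clan :: "'a set \<Rightarrow> ('a \<Rightarrow> 'a \<Rightarrow> 'b) \<Rightarrow> 'a set \<Rightarrow> bool" where
  "clan V f X \<longleftrightarrow> X \<subseteq> V \<and> (\<forall>i\<in>X. \<forall>j\<in>X. \<forall>k\<in>V - X. f i k = f j k \<and> f k i = f k j)"

definition pfaffian :: "('a \<Rightarrow> 'a \<Rightarrow> 'b :: comm_ring_1) \<Rightarrow> 'a \<Rightarrow> 'a \<Rightarrow> 'a \<Rightarrow> 'a \<Rightarrow> 'b" where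
  "pfaffian s i j k l = s i j * s k l - s i k * s j l + s i l * s j k"

text \<open>Equality of the principal minors of orders 2, 3 and 4, expressed in the skew part: a minor of
  order 3 is a polynomial in squared entries and the squared Pfaffian of the skew matrix bordered
  by ones, one of order 4 moreover involves the squared Pfaffian of the quadruple.\<close>

definition minors_agree :: "'a set \<Rightarrow> ('a \<Rightarrow> 'a \<Rightarrow> 'b :: comm_ring_1) \<Rightarrow> ('a \<Rightarrow> 'a \<Rightarrow> 'b) \<Rightarrow> bool" where
  "minors_agree V s t \<longleftrightarrow>
     (\<forall>i\<in>V. \<forall>j\<in>V. (s i j)\<^sup>2 = (t i j)\<^sup>2) \<and>
     (\<forall>i\<in>V. \<forall>j\<in>V. \<forall>k\<in>V. (s i j + s j k + s k i)\<^sup>2 = (t i j + t j k + t k i)\<^sup>2) \<and>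
     (\<forall>i\<in>V. \<forall>j\<in>V. \<forall>k\<in>V. \<forall>l\<in>V. (pfaffian s i j k l)\<^sup>2 = (pfaffian t i j k l)\<^sup>2)"

definition differ :: "('a \<Rightarrow> 'a \<Rightarrow> 'b) \<Rightarrow> ('a \<Rightarrow> 'a \<Rightarrow> 'b) \<Rightarrow> 'a \<Rightarrow> 'a \<Rightarrow> bool" where
  "differ s t i j \<longleftrightarrow> s i j \<noteq> t i j"

abbreviation (input) neg :: "('a \<Rightarrow> 'a \<Rightarrow> 'b :: ab_group_add) \<Rightarrow> 'a \<Rightarrow> 'a \<Rightarrow> 'b" where
  "neg t \<equiv> \<lambda>i j. - t i j"

lemma skew_onD: "skew_on V s \<Longrightarrow> i \<in> V \<Longrightarrow> j \<in> V \<Longrightarrow> s j i = - s i j"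
  unfolding skew_on_def by blast

lemma skew_on_subset: "skew_on V s \<Longrightarrow> W \<subseteq> V \<Longrightarrow> skew_on W s"
  unfolding skew_on_def by blast

lemma skew_on_neg: "skew_on V s \<Longrightarrow> skew_on V (neg s)"
  unfolding skew_on_def by metis

lemma skew_on_diagonal:
  fixes s :: "'a \<Rightarrow> 'a \<Rightarrow> 'b :: {idom, ring_char_0}"
  assumes "skew_on V s" "i \<in> V"
  shows "s i i = 0"
proof -
  have "2 * s i i = 0" using skew_onD[OF assms(1,2,2)] by (metis add.right_inverse mult_2)
  then show ?thesis by simp
qed

lemma clanI_skew_on:
  assumes s: "skew_on V s" and X: "X \<subseteq> V"
    and rows: "\<And>i j k. i \<in> X \<Longrightarrow> j \<in> X \<Longrightarrow> k \<in> V - X \<Longrightarrow> s i k = s j k"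
  shows "clan V s X"
proof -
  have "s i k = s j k \<and> s k i = s k j" if "i \<in> X" "j \<in> X" "k \<in> V - X" for i j k
    using rows[OF that] skew_onD[OF s, of i k] skew_onD[OF s, of j k] X that
    by (metis DiffD1 subsetD)
  then show ?thesis unfolding clan_def using X by blast
qed

lemma has_cut_uminus:
  assumes s: "skew_on V s" and "has_cut V s a"
  shows "has_cut V s (- a)"
proof -
  obtain P where P: "P \<subset> V" "P \<noteq> {}" "\<forall>p\<in>P. \<forall>q\<in>V - P. s p q = a"
    using assms(2) by (rule has_cutE)
  show ?thesis
  proof (rule has_cutI[of "V - P"])
    fix p q assume "p \<in> V - P" "q \<in> V - (V - P)"
    then show "s p q = - a" using P(3) skew_onD[OF s, of q p] by auto
  qed (use P in blast)+
qed

lemma clan_if_cut: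
  assumes s: "skew_on V s" and "P \<subseteq> V" and cut: "\<forall>p\<in>P. \<forall>q\<in>V - P. s p q = a"
  shows "clan V s P" "clan V s (V - P)"
proof -
  have "s i k = - a" if "i \<in> V - P" "k \<in> V - (V - P)" for i k
    using that cut skew_onD[OF s, of k i] by auto
  then show "clan V s (V - P)" by (intro clanI_skew_on[OF s]) auto
qed (use assms in \<open>auto intro: clanI_skew_on[OF s]\<close>)

lemma minors_agree_sym: "minors_agree V s t \<Longrightarrow> minors_agree V t s"
  unfolding minors_agree_def by simp

lemma minors_agree_trans: "minors_agree V s t \<Longrightarrow> minors_agree V t u \<Longrightarrow> minors_agree V s u"
  unfolding minors_agree_def by simp

lemma minors_agree_subset: "minors_agree V s t \<Longrightarrow> W \<subseteq> V \<Longrightarrow> minors_agree W s t"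
  unfolding minors_agree_def by blast

lemma minors_agree_neg: "minors_agree V s (neg s)"
proof -
  have "(- x + - y + - z)\<^sup>2 = (x + y + z)\<^sup>2" for x y z :: 'b
    by (metis minus_add_distrib power2_minus)
  then show ?thesis unfolding minors_agree_def pfaffian_def by (simp del: add_uminus_conv_diff)
qed

text \<open>A pair with entry 0 is neither \<open>reversed\<close> nor \<open>kept\<close>. Negating \<open>t\<close> exchanges the two graphs.\<close>

locale skew_pair =
  fixes V :: "'a set" and s t :: "'a \<Rightarrow> 'a \<Rightarrow> 'b :: {idom, ring_char_0}"
  assumes skew_s: "skew_on V s" and skew_t: "skew_on V t" and minors: "minors_agree V s t"
begin

abbreviation reversed :: "'a \<Rightarrow> 'a \<Rightarrow> bool" where "reversed \<equiv> differ s t"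

abbreviation kept :: "'a \<Rightarrow> 'a \<Rightarrow> bool" where "kept \<equiv> differ s (neg t)"

lemma neg: "skew_pair V s (neg t)"
  using skew_s skew_on_neg[OF skew_t] minors_agree_trans[OF minors minors_agree_neg]
  by unfold_locales

lemma subset: "W \<subseteq> V \<Longrightarrow> skew_pair W s t"
  using skew_on_subset[OF skew_s] skew_on_subset[OF skew_t] minors_agree_subset[OF minors]
  by unfold_locales

lemma entry_cases: "i \<in> V \<Longrightarrow> j \<in> V \<Longrightarrow> t i j = s i j \<or> t i j = - s i j"
  using minors unfolding minors_agree_def by (metis power2_eq_iff)

lemma reversed_nonzero: "i \<in> V \<Longrightarrow> j \<in> V \<Longrightarrow> reversed i j \<Longrightarrow> s i j \<noteq> 0"
  using entry_cases unfolding differ_def by force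

lemma reversed_uminus: "i \<in> V \<Longrightarrow> j \<in> V \<Longrightarrow> reversed i j \<Longrightarrow> t i j = - s i j"
  using entry_cases unfolding differ_def by metis

lemma kept_iff:
  assumes "i \<in> V" "j \<in> V"
  shows "kept i j \<longleftrightarrow> s i j \<noteq> 0 \<and> \<not> reversed i j"
proof -
  have "s i j = - s i j \<longleftrightarrow> s i j = 0"
    by (metis add.right_inverse mult_2 mult_eq_0_iff neg_equal_0_iff_equal zero_neq_numeral)
  then show ?thesis using entry_cases[OF assms] unfolding differ_def by auto
qed

lemma reversed_sym: "i \<in> V \<Longrightarrow> j \<in> V \<Longrightarrow> reversed i j \<longleftrightarrow> reversed j i"
  unfolding differ_def using skew_onD[OF skew_s] skew_onD[OF skew_t] by (metis minus_minus)

lemma kept_sym: "i \<in> V \<Longrightarrow> j \<in> V \<Longrightarrow> kept i j \<longleftrightarrow> kept j i"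
  by (rule skew_pair.reversed_sym[OF neg])

lemma reversed_triangle:
  assumes V: "i \<in> V" "j \<in> V" "k \<in> V" and "reversed i j" "\<not> reversed i k" "\<not> reversed j k"
  shows "s i k = s j k"
proof -
  have "(s i j + s j k + s k i)\<^sup>2 = (t i j + t j k + t k i)\<^sup>2"
    using minors V unfolding minors_agree_def by blast
  moreover have "t i j = - s i j" using reversed_uminus assms by blast
  moreover have "t j k = s j k" "t k i = - s i k" "s k i = - s i k"
    using assms skew_onD[OF skew_s, of i k] skew_onD[OF skew_t, of i k] unfolding differ_def by auto
  ultimately have "(s i j + (s j k - s i k))\<^sup>2 = (- s i j + (s j k - s i k))\<^sup>2"
    by (simp add: algebra_simps)
  then have "s i j * (s j k - s i k) = 0" by (simp add: power2_eq_square algebra_simps)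
  then show ?thesis using reversed_nonzero assms by auto
qed

lemmas kept_triangle = skew_pair.reversed_triangle[OF neg]

lemma no_rainbow_triangle:
  assumes V: "i \<in> V" "j \<in> V" "k \<in> V" and "reversed i j" "kept i k"
  shows "s j k \<noteq> 0"
proof
  assume "s j k = 0"
  then have "\<not> reversed j k" "\<not> reversed i k" using reversed_nonzero kept_iff assms by blast+
  then have "s i k = 0" using reversed_triangle[of i j k] assms \<open>s j k = 0\<close> by simp
  then show False using kept_iff assms by blast
qed

text \<open>The hypothesis on the minors of order 4 is used only here.\<close>

lemma square_eq_if_alternating_path:
  assumes V: "x \<in> V" "y \<in> V" "k \<in> V" "z \<in> V"
    and kept: "kept y x" "kept x k" "kept k z"
    and reversed: "reversed k y" "reversed y z" "reversed z x"
  shows "(s z k)\<^sup>2 = (s z x)\<^sup>2"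
proof -
  note skew = skew_onD[OF skew_s]
  define b c where "b = s z k" and "c = s z x"
  have not_reversed: "\<not> reversed y x" "\<not> reversed k x" "\<not> reversed z k" "\<not> reversed x k"
    and not_kept: "\<not> kept k y" "\<not> kept z y" "\<not> kept y z" "\<not> kept x z"
    using assms kept_iff reversed_sym by blast+
  have zk: "s z k = b" and zx: "s z x = c" by (simp_all add: b_def c_def)
  have xk: "s x k = b"
    using reversed_triangle[of z x k] V reversed(3) not_reversed zk by simp
  have zy: "s z y = c"
    using kept_triangle[of y x z] V kept(1) not_kept zx skew[of z y] skew[of z x] by simp
  have ky: "s k y = c"
    using kept_triangle[of k z y] V kept(3) not_kept zy by simp
  have "s k x = s y x"
    using reversed_triangle[of k y x] V reversed(1) not_reversed by simp
  then have xy: "s x y = b" using xk V skew[of y x] skew[of k x] by simp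
  have s_entries: "s x y = b" "s x k = b" "s y k = - c" "s x z = - c" "s y z = - c" "s k z = - b"
    using xy xk ky zx zy zk V skew[of k y] skew[of z x] skew[of z y] skew[of z k] by simp_all
  have "t x y = s x y" "t x k = s x k" "t k z = s k z"
    using V kept kept_sym kept_iff unfolding differ_def by metis+
  moreover have "t y k = - s y k" "t x z = - s x z" "t y z = - s y z"
    using V reversed reversed_sym reversed_uminus by metis+
  ultimately have t_entries:
    "t x y = b" "t x k = b" "t y k = c" "t x z = c" "t y z = c" "t k z = - b"
    using s_entries by simp_all
  have "(pfaffian s x y k z)\<^sup>2 = (pfaffian t x y k z)\<^sup>2"
    using minors V unfolding minors_agree_def by blast
  then have "b * c * (c\<^sup>2 - b\<^sup>2) = 0"
    unfolding pfaffian_def s_entries t_entries by (simp add: power2_eq_square algebra_simps)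
  moreover have "b \<noteq> 0" "c \<noteq> 0"
    using kept(3) reversed(3) V kept_iff[of k z] reversed_nonzero[of z x] s_entries(6) zx by auto
  ultimately show ?thesis unfolding zk zx by simp
qed

lemma clan_if_reversed_component:
  assumes C: "C \<subseteq> V" "connected_on C reversed" and out: "\<And>c y. c \<in> C \<Longrightarrow> y \<in> V - C \<Longrightarrow> \<not> reversed c y"
  shows "clan V s C"
proof (rule clanI_skew_on[OF skew_s C(1)])
  fix i j k assume "i \<in> C" "j \<in> C" and k: "k \<in> V - C"
  show "s i k = s j k"
  proof (rule connected_on_constant[OF C(2) _ \<open>i \<in> C\<close> \<open>j \<in> C\<close>])
    fix p q assume "p \<in> C" "q \<in> C" "reversed p q"
    then show "s p k = s q k" using reversed_triangle[of p q k] C(1) k out by blast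
  qed
qed

end

section \<open>A cut from two connected colours\<close>

lemma (in skew_pair) four_le_card_if_both_connected:
  assumes fin: "finite V" and card: "2 \<le> card V"
    and connected: "connected_on V reversed" "connected_on V kept"
  shows "4 \<le> card V"
proof -
  have nontrivial: "V - {x} \<noteq> {}" for x
    using card card_mono[of "{x}" V] by force
  have ex_reversed: "\<exists>q\<in>V - {x}. reversed x q" if "x \<in> V" for x
    by (rule connected_on_neighbour[OF connected(1) that nontrivial]) blast
  have ex_kept: "\<exists>q\<in>V - {x}. kept x q" if "x \<in> V" for x
    by (rule connected_on_neighbour[OF connected(2) that nontrivial]) blast
  obtain x where x: "x \<in> V" using card by fastforce
  obtain y where y: "y \<in> V" "y \<noteq> x" "reversed x y" using ex_reversed[OF x] by blast
  obtain z where z: "z \<in> V" "z \<noteq> x" "kept x z" using ex_kept[OF x] by blast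
  have "y \<noteq> z" using kept_iff x y z by blast
  moreover have "V \<noteq> {x, y, z}"
  proof
    assume "V = {x, y, z}"
    then have "kept y z" using ex_kept[OF y(1)] kept_iff[of y x] reversed_sym[of x y] x y by blast
    moreover have "reversed z y"
      using \<open>V = {x, y, z}\<close> ex_reversed[OF z(1)] kept_iff[of x z] reversed_sym[of x z] x z by blast
    ultimately show False using kept_iff[of y z] reversed_sym[of z y] y(1) z(1) by blast
  qed
  then obtain w where "w \<in> V" "w \<notin> {x, y, z}" using x y z by blast
  ultimately have "card {w, x, y, z} = 4" "{w, x, y, z} \<subseteq> V" using x y z by auto
  then show ?thesis using card_mono[OF fin] by metis
qed

lemma (in skew_pair) has_square_cut_if_square_constant_row:
  assumes l: "l \<in> V" and row: "\<And>x. x \<in> V - {l} \<Longrightarrow> (s l x)\<^sup>2 = d"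
    and "u \<in> V - {l}" "reversed l u" and "w \<in> V - {l}" "kept l w"
  shows "has_cut (V - {l}) (\<lambda>i j. (s i j)\<^sup>2) d"
proof (rule has_cutI[of "{x \<in> V - {l}. reversed l x}"])
  show "{x \<in> V - {l}. reversed l x} \<subset> V - {l}" "{x \<in> V - {l}. reversed l x} \<noteq> {}"
    using assms kept_iff[of l w] by blast+
  fix p q assume "p \<in> {x \<in> V - {l}. reversed l x}" "q \<in> V - {l} - {x \<in> V - {l}. reversed l x}"
  then have pq: "p \<in> V" "q \<in> V" "p \<noteq> l" "q \<noteq> l" "reversed l p" "\<not> reversed l q" by auto
  have "d \<noteq> 0" using row[of u] reversed_nonzero[of l u] assms by auto
  then have "kept l q" using row[of q] pq kept_iff[of l q] l by auto
  show "(s p q)\<^sup>2 = d"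
  proof (cases "reversed p q")
    case True
    then have "\<not> kept l p" "\<not> kept q p" using kept_iff reversed_sym l pq by blast+
    then have "s l p = s q p" using kept_triangle[of l q p] \<open>kept l q\<close> l pq by blast
    then show ?thesis using row[of p] pq skew_onD[OF skew_s, of q p] by simp
  next
    case False
    then have "s l q = s p q" using reversed_triangle[of l p q] l pq by blast
    then show ?thesis using row[of q] pq by simp
  qed
qed

lemma (in skew_pair) has_square_cut_delete_vertex:
  assumes connected: "connected_on V reversed" "connected_on V kept"
    and cut: "has_cut V s a" and l: "l \<in> V" "V - {l} \<noteq> {}"
  shows "has_cut (V - {l}) (\<lambda>i j. (s i j)\<^sup>2) (a\<^sup>2)"
proof -
  obtain P where P: "P \<subset> V" "P \<noteq> {}" "\<forall>p\<in>P. \<forall>q\<in>V - P. s p q = a"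
    using cut by (rule has_cutE)
  show ?thesis
  proof (cases "P = {l} \<or> V - P = {l}")
    case True
    have "(s l x)\<^sup>2 = a\<^sup>2" if "x \<in> V - {l}" for x
      using True
    proof
      assume "V - P = {l}"
      then have "s x l = a" using P(3) that by blast
      then show ?thesis using skew_onD[OF skew_s, of x l] l that by auto
    qed (use P(3) that in auto)
    moreover obtain u where "u \<in> V - {l}" "reversed l u"
      using connected(1) l by (rule connected_on_neighbour)
    moreover obtain w where "w \<in> V - {l}" "kept l w"
      using connected(2) l by (rule connected_on_neighbour)
    ultimately show ?thesis using has_square_cut_if_square_constant_row[OF l(1)] by blast
  next
    case False
    show ?thesis
    proof (rule has_cutI[of "P - {l}"])
      show "P - {l} \<subset> V - {l}" "P - {l} \<noteq> {}" using False P(1,2) by blast+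
    qed (use P in auto)
  qed
qed

text \<open>With \<open>Z = V - {k} - C\<close>, it turns out that \<open>s\<close> is constant from \<open>Z\<close> to \<open>C \<union> {k}\<close> or from
  \<open>Z \<union> {k}\<close> to \<open>C\<close>, with value \<open>s k y\<^sub>0\<close>.\<close>

locale kept_cut_vertex = skew_pair V s t
  for V :: "'a set" and s t :: "'a \<Rightarrow> 'a \<Rightarrow> 'b :: {idom, ring_char_0}" +
  fixes k y\<^sub>0 :: 'a and C :: "'a set"
  assumes kept_connected: "connected_on V kept"
    and k: "k \<in> V" and C_psubset: "C \<subset> V - {k}" and y\<^sub>0: "y\<^sub>0 \<in> C" "reversed k y\<^sub>0"
    and C_connected: "connected_on C kept"
    and not_kept_across: "\<And>x z. x \<in> C \<Longrightarrow> z \<in> V - {k} - C \<Longrightarrow> \<not> kept x z"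
begin

definition Z :: "'a set" where "Z = V - {k} - C"

definition cut_value :: 'b where "cut_value = s k y\<^sub>0"

lemma C_in: "x \<in> C \<Longrightarrow> x \<in> V \<and> x \<noteq> k" using C_psubset by blast

lemma Z_in: "z \<in> Z \<Longrightarrow> z \<in> V \<and> z \<noteq> k \<and> z \<notin> C" unfolding Z_def by blast

lemma Z_nonempty: "Z \<noteq> {}" unfolding Z_def using C_psubset by blast

lemma not_kept_Z_C: "z \<in> Z \<Longrightarrow> x \<in> C \<Longrightarrow> \<not> kept z x"
  using not_kept_across kept_sym[of z x] C_in Z_in unfolding Z_def by blast

lemma cut_value_nonzero: "cut_value \<noteq> 0"
  unfolding cut_value_def using reversed_nonzero y\<^sub>0 C_in k by blast

lemma kept_edge_from_k:
  assumes R: "R \<subseteq> V - {k}" "R \<noteq> {}" "\<And>r v. r \<in> R \<Longrightarrow> v \<in> V - {k} - R \<Longrightarrow> \<not> kept r v"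
  obtains r where "r \<in> R" "kept k r"
proof -
  have "R \<subset> V" using R(1) k by blast
  then obtain r v where "r \<in> R" "v \<in> V - R" "kept r v"
    using R(2) by (rule connected_onE[OF kept_connected])
  moreover from this have "v = k" using R(3) by blast
  ultimately show thesis using that[of r] kept_sym[of r k] R(1) k by blast
qed

lemma ex_kept_C: obtains x where "x \<in> C" "kept k x"
  using kept_edge_from_k[of C] C_psubset y\<^sub>0(1) not_kept_across by blast

lemma ex_kept_Z: obtains z where "z \<in> Z" "kept k z"
proof (rule kept_edge_from_k[of Z])
  show "\<not> kept r v" if "r \<in> Z" "v \<in> V - {k} - Z" for r v
    using that not_kept_Z_C unfolding Z_def by blast
qed (use Z_nonempty in \<open>auto simp: Z_def\<close>)

lemma row_constant_on_C:
  assumes "z \<in> Z" "x \<in> C" "y \<in> C"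
  shows "s z x = s z y"
proof (rule connected_on_constant[OF C_connected _ assms(2,3)])
  fix p q assume pq: "p \<in> C" "q \<in> C" "kept p q"
  then have "s p z = s q z"
    using kept_triangle[of p q z] not_kept_across[of _ z] C_in Z_in assms(1)
    unfolding Z_def by blast
  then show "s z p = s z q"
    using skew_onD[OF skew_s, of p z] skew_onD[OF skew_s, of q z] pq C_in Z_in assms(1) by auto
qed

lemma value_Z_C:
  assumes "z \<in> Z" "x \<in> C"
  shows "s z x = cut_value"
proof -
  have "s z y\<^sub>0 = cut_value"
  proof (rule ccontr)
    assume "s z y\<^sub>0 \<noteq> cut_value"
    define R where "R = {r \<in> Z. s r y\<^sub>0 \<noteq> cut_value}"
    have "\<not> kept r v" if r: "r \<in> R" and v: "v \<in> V - {k} - R" for r v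
    proof
      assume "kept r v"
      then have "v \<in> Z" using not_kept_Z_C r v unfolding R_def Z_def by blast
      then have "s r y\<^sub>0 = s v y\<^sub>0"
        using kept_triangle[of r v y\<^sub>0] \<open>kept r v\<close> not_kept_Z_C Z_in C_in y\<^sub>0(1) r
        unfolding R_def by blast
      then show False using r v \<open>v \<in> Z\<close> unfolding R_def by auto
    qed
    moreover have "R \<subseteq> V - {k}" "R \<noteq> {}"
      using \<open>s z y\<^sub>0 \<noteq> cut_value\<close> assms(1) unfolding R_def Z_def by blast+
    ultimately obtain r where r: "r \<in> R" "kept k r" using kept_edge_from_k[of R] by blast
    then have "r \<in> Z" unfolding R_def by blast
    moreover have "\<not> kept k y\<^sub>0" using kept_iff[of k y\<^sub>0] y\<^sub>0 C_in k by blast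
    ultimately have "s k y\<^sub>0 = s r y\<^sub>0"
      using kept_triangle[of k r y\<^sub>0] r(2) not_kept_Z_C Z_in C_in y\<^sub>0(1) k by blast
    then show False using r(1) unfolding R_def cut_value_def by auto
  qed
  then show ?thesis using row_constant_on_C assms y\<^sub>0(1) by metis
qed

lemma reversed_Z_C: "z \<in> Z \<Longrightarrow> x \<in> C \<Longrightarrow> reversed z x"
  using kept_iff[of z x] not_kept_Z_C value_Z_C cut_value_nonzero Z_in C_in by auto

lemma reversed_or_kept_from_k:
  assumes v: "v \<in> V - {k}"
  shows "reversed k v \<or> kept k v"
proof -
  obtain x where x: "x \<in> C" "kept k x" by (rule ex_kept_C)
  obtain z where z: "z \<in> Z" "kept k z" by (rule ex_kept_Z)
  have in_V: "x \<in> V" "z \<in> V" using x z C_in Z_in by blast+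
  have "s v k \<noteq> 0"
  proof (cases "v \<in> C")
    case True
    then show ?thesis
      using no_rainbow_triangle[of z v k] reversed_Z_C z kept_sym[of k z] in_V k v by blast
  next
    case False
    then have "reversed x v"
      using reversed_Z_C[of v x] reversed_sym[of x v] x in_V v unfolding Z_def by blast
    then show ?thesis using no_rainbow_triangle[of x v k] x kept_sym[of k x] in_V k v by blast
  qed
  then show ?thesis using kept_iff[of k v] skew_onD[OF skew_s, of k v] k v by auto
qed

lemma value_reversed_C:
  assumes "y \<in> C" "reversed k y"
  shows "s k y = cut_value"
proof -
  obtain z where z: "z \<in> Z" "kept k z" by (rule ex_kept_Z)
  have "\<not> kept k y" using kept_iff assms C_in k by blast
  then have "s k y = s z y"
    using kept_triangle[of k z y] z not_kept_Z_C assms Z_in C_in k by blast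
  then show ?thesis using value_Z_C z(1) assms(1) by simp
qed

lemma value_reversed_Z:
  assumes "z \<in> Z" "reversed k z"
  shows "s z k = cut_value"
proof -
  obtain x where x: "x \<in> C" "kept k x" by (rule ex_kept_C)
  have "\<not> kept k z" "\<not> kept x z"
    using kept_iff assms Z_in k not_kept_across x unfolding Z_def by blast+
  then have "s k z = s x z" using kept_triangle[of k x z] x assms Z_in C_in k by blast
  then show ?thesis
    using value_Z_C[OF assms(1) x(1)] skew_onD[OF skew_s, of k z] skew_onD[OF skew_s, of x z]
      assms Z_in C_in[OF x(1)] k by auto
qed

lemma value_kept_eq:
  assumes "z \<in> Z" "kept k z" "x \<in> C" "kept k x"
  shows "s x k = s z k"
proof -
  have "\<not> reversed z k" "\<not> reversed x k"
    using kept_iff reversed_sym assms Z_in C_in k by blast+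
  then show ?thesis using reversed_triangle[of z x k] reversed_Z_C assms Z_in C_in k by metis
qed

lemma square_value_kept:
  assumes "z \<in> Z" "kept k z"
  shows "(s z k)\<^sup>2 = cut_value\<^sup>2"
proof -
  obtain x\<^sub>0 where x\<^sub>0: "x\<^sub>0 \<in> C" "kept k x\<^sub>0" by (rule ex_kept_C)
  define Y where "Y = {y \<in> C. reversed k y}"
  have "Y \<subset> C" "Y \<noteq> {}" unfolding Y_def using x\<^sub>0 y\<^sub>0 kept_iff[of k x\<^sub>0] C_in k by blast+
  then obtain y x where yx: "y \<in> Y" "x \<in> C - Y" "kept y x"
    by (rule connected_onE[OF C_connected])
  then have x: "x \<in> C" "kept k x" and y: "y \<in> C" "reversed k y"
    using reversed_or_kept_from_k[of x] C_in unfolding Y_def by blast+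
  have "reversed y z"
    using reversed_Z_C[OF assms(1) y(1)] reversed_sym[of z y] assms y Z_in C_in by blast
  moreover have "kept x k" using x(2) kept_sym[of k x] x C_in k by blast
  ultimately have "(s z k)\<^sup>2 = (s z x)\<^sup>2"
    using square_eq_if_alternating_path[of x y k z] yx(3) y x assms reversed_Z_C Z_in C_in k
    by blast
  then show ?thesis using value_Z_C[OF assms(1) x(1)] by simp
qed

lemma has_cut_cut_value: "has_cut V s cut_value"
proof -
  obtain z\<^sub>0 where z\<^sub>0: "z\<^sub>0 \<in> Z" "kept k z\<^sub>0" by (rule ex_kept_Z)
  obtain x\<^sub>0 where x\<^sub>0: "x\<^sub>0 \<in> C" "kept k x\<^sub>0" by (rule ex_kept_C)
  consider (cut_to_k) "s z\<^sub>0 k = cut_value" | (cut_from_k) "s z\<^sub>0 k = - cut_value"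
    using square_value_kept[OF z\<^sub>0] power2_eq_iff by blast
  then show ?thesis
  proof cases
    case cut_to_k
    have "s z k = cut_value" if "z \<in> Z" for z
      using reversed_or_kept_from_k[of z] value_reversed_Z value_kept_eq[OF _ _ x\<^sub>0]
        value_kept_eq[OF z\<^sub>0 x\<^sub>0] cut_to_k that Z_in by force
    then have "s z v = cut_value" if "z \<in> Z" "v \<in> V - Z" for z v
      using that value_Z_C unfolding Z_def by blast
    then show ?thesis using Z_nonempty Z_in k by (intro has_cutI[of Z]) blast+
  next
    case cut_from_k
    have "s k x = cut_value" if "x \<in> C" for x
      using reversed_or_kept_from_k[of x] value_reversed_C value_kept_eq[OF z\<^sub>0] cut_from_k
        skew_onD[OF skew_s, of x k] that C_in k by force
    then have "s v x = cut_value" if "v \<in> V - C" "x \<in> C" for v x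
      using that value_Z_C unfolding Z_def by blast
    then show ?thesis using y\<^sub>0(1) k C_in by (intro has_cutI[of "V - C"]) blast+
  qed
qed

end

lemma (in skew_pair) nonzero_cut_if_kept_disconnected_by_vertex:
  assumes fin: "finite V" and connected: "connected_on V reversed" "connected_on V kept"
    and k: "k \<in> V" "V - {k} \<noteq> {}" and disconnected: "\<not> connected_on (V - {k}) kept"
  shows "\<exists>a. a \<noteq> 0 \<and> has_cut V s a"
proof -
  obtain y\<^sub>0 where y\<^sub>0: "y\<^sub>0 \<in> V - {k}" "reversed k y\<^sub>0"
    using connected(1) k by (rule connected_on_neighbour)
  have "symp_on (V - {k}) kept" using kept_sym by (intro symp_onI) blast
  then obtain C where C: "y\<^sub>0 \<in> C" "C \<subseteq> V - {k}" "connected_on C kept"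
      "\<And>x z. x \<in> C \<Longrightarrow> z \<in> V - {k} - C \<Longrightarrow> \<not> kept x z"
    using connected_component_exists[OF finite_Diff[OF fin] _ y\<^sub>0(1)] by metis
  then interpret kept_cut_vertex V s t k y\<^sub>0 C
    using connected(2) k(1) y\<^sub>0(2) disconnected by unfold_locales blast+
  show ?thesis using cut_value_nonzero has_cut_cut_value by blast
qed

lemma (in skew_pair) nonzero_cut_if_deletions_have_nonzero_cuts:
  assumes fin: "finite V" and card: "4 \<le> card V"
    and connected: "\<And>k. k \<in> V \<Longrightarrow> connected_on (V - {k}) reversed \<and> connected_on (V - {k}) kept"
    and cuts: "\<And>k. k \<in> V \<Longrightarrow> \<exists>a. a \<noteq> 0 \<and> has_cut (V - {k}) s a"
  shows "\<exists>a. a \<noteq> 0 \<and> has_cut V s a"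
proof (rule ccontr)
  assume no_cut: "\<not> ?thesis"
  obtain k where k: "k \<in> V" using card by fastforce
  obtain a where a: "a \<noteq> 0" "has_cut (V - {k}) s a" using cuts[OF k] by blast
  have "totalp_on V (\<lambda>i j. s i j \<noteq> a)"
  proof (rule totalp_onI)
    fix i j assume "i \<in> V" "j \<in> V"
    then show "s i j \<noteq> a \<or> s j i \<noteq> a" using skew_onD[OF skew_s, of i j] a(1) by auto
  qed
  then obtain l where l: "l \<in> V" "\<not> has_cut (V - {l}) s a"
    using connected_on_delete_vertex[OF fin card] no_cut a(1) unfolding has_cut_def by blast
  obtain b where b: "b \<noteq> 0" "has_cut (V - {l}) s b" using cuts[OF l(1)] by blast
  have "k \<noteq> l" using a(2) l(2) by blast
  have "\<not> V \<subseteq> {k, l}"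
    using card card_mono[of "{k, l}" V] by (auto simp: card_insert_if split: if_splits)
  then have ne: "V - {k} - {l} \<noteq> {}" "V - {l} - {k} \<noteq> {}" by blast+
  interpret del_k: skew_pair "V - {k}" s t by (rule subset) blast
  interpret del_l: skew_pair "V - {l}" s t by (rule subset) blast
  have cut_a: "has_cut (V - {k} - {l}) (\<lambda>i j. (s i j)\<^sup>2) (a\<^sup>2)"
    using del_k.has_square_cut_delete_vertex[OF _ _ a(2) _ ne(1)] connected k l(1) \<open>k \<noteq> l\<close> by blast
  have "has_cut (V - {l} - {k}) (\<lambda>i j. (s i j)\<^sup>2) (b\<^sup>2)"
    using del_l.has_square_cut_delete_vertex[OF _ _ b(2) _ ne(2)] connected k l(1) \<open>k \<noteq> l\<close> by blast
  moreover have "V - {l} - {k} = V - {k} - {l}" by blast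
  ultimately have cut_b: "has_cut (V - {k} - {l}) (\<lambda>i j. (s i j)\<^sup>2) (b\<^sup>2)" by simp
  have "(s j i)\<^sup>2 = (s i j)\<^sup>2" if "i \<in> V - {k} - {l}" "j \<in> V - {k} - {l}" for i j
    using skew_onD[OF skew_s, of i j] that by simp
  then have "a\<^sup>2 = b\<^sup>2" using cut_a cut_b by (rule has_cut_unique)
  then have "a = b \<or> a = - b" by (simp add: power2_eq_iff)
  then show False using l(2) b(2) has_cut_uminus[OF del_l.skew_s b(2)] by blast
qed

theorem nonzero_cut_if_both_connected:
  assumes "skew_pair V s t" "finite V" "2 \<le> card V"
    and "connected_on V (differ s t)" "connected_on V (differ s (neg t))"
  shows "\<exists>a. a \<noteq> 0 \<and> has_cut V s a"
  using assms
proof (induction V rule: measure_induct_rule[where f = card])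
  case (less V)
  interpret skew_pair V s t by (rule less.prems(1))
  interpret neg: skew_pair V s "neg t" by (rule neg)
  note fin = less.prems(2) and both_connected = less.prems(4,5)
  have card: "4 \<le> card V" using four_le_card_if_both_connected less.prems(2-5) by blast
  have deletion: "finite (V - {k})" "card (V - {k}) < card V" "2 \<le> card (V - {k})" if "k \<in> V" for k
    using that fin card by (simp_all add: card_Diff_singleton)
  have ne: "V - {k} \<noteq> {}" if "k \<in> V" for k using deletion(3)[OF that] by force
  consider (kept_disconnected) k where "k \<in> V" "\<not> connected_on (V - {k}) kept"
    | (reversed_disconnected) k where "k \<in> V" "\<not> connected_on (V - {k}) reversed"
    | (connected) "\<And>k. k \<in> V \<Longrightarrow> connected_on (V - {k}) reversed \<and> connected_on (V - {k}) kept"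
    by blast
  then show ?case
  proof cases
    case (kept_disconnected k)
    then show ?thesis
      using nonzero_cut_if_kept_disconnected_by_vertex[OF fin both_connected] ne by blast
  next
    case (reversed_disconnected k)
    then show ?thesis
      using neg.nonzero_cut_if_kept_disconnected_by_vertex[OF fin both_connected(2)]
        both_connected(1) ne by simp
  next
    case connected
    have "\<exists>a. a \<noteq> 0 \<and> has_cut (V - {k}) s a" if "k \<in> V" for k
      using less.IH[OF deletion(2) subset deletion(1,3)] that connected by blast
    with connected show ?thesis by (rule nonzero_cut_if_deletions_have_nonzero_cuts[OF fin card])
  qed
qed

section \<open>Clan inversions\<close>

definition agree_on :: "'a set \<Rightarrow> ('a \<Rightarrow> 'a \<Rightarrow> 'b) \<Rightarrow> ('a \<Rightarrow> 'a \<Rightarrow> 'b) \<Rightarrow> bool" where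
  "agree_on V f g \<longleftrightarrow> (\<forall>i\<in>V. \<forall>j\<in>V. f i j = g i j)"

definition flip :: "'a set \<Rightarrow> ('a \<Rightarrow> 'a \<Rightarrow> 'b) \<Rightarrow> 'a \<Rightarrow> 'a \<Rightarrow> 'b" where
  "flip X f = (\<lambda>i j. if i \<in> X \<and> j \<in> X then f j i else f i j)"

text \<open>Only the values on \<open>V\<close> count: a function may be replaced by any other one agreeing with it on
  \<open>V\<close>, which is the case \<open>X = {}\<close>.\<close>

definition clan_inversion :: "'a set \<Rightarrow> ('a \<Rightarrow> 'a \<Rightarrow> 'b) \<Rightarrow> ('a \<Rightarrow> 'a \<Rightarrow> 'b) \<Rightarrow> bool" where
  "clan_inversion V f g \<longleftrightarrow> (\<exists>X. clan V f X \<and> agree_on V g (flip X f))"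

lemma agree_on_refl: "agree_on V f f"
  unfolding agree_on_def by simp

lemma agree_on_flip: "agree_on V f g \<Longrightarrow> agree_on V (flip X f) (flip X g)"
  unfolding agree_on_def flip_def by simp

lemma clan_subset: "clan V f X \<Longrightarrow> X \<subseteq> V"
  unfolding clan_def by blast

lemma clan_agree_on: "clan V f X \<Longrightarrow> agree_on V g f \<Longrightarrow> clan V g X"
  unfolding clan_def agree_on_def by (metis DiffD1 in_mono)

lemma clan_trans: "clan V f X \<Longrightarrow> clan X f Y \<Longrightarrow> clan V f Y"
  unfolding clan_def by blast

lemma clan_flip:
  assumes "clan V f A" and laminar: "A \<subseteq> B \<or> B \<subseteq> A \<or> A \<inter> B = {}"
  shows "clan V (flip B f) A"
proof -
  have "flip B f i k = flip B f j k \<and> flip B f k i = flip B f k j"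
    if "i \<in> A" "j \<in> A" "k \<in> V - A" for i j k
  proof -
    have "f i k = f j k" "f k i = f k j" using assms(1) that unfolding clan_def by blast+
    moreover have "k \<in> B \<Longrightarrow> i \<in> B \<longleftrightarrow> j \<in> B" using laminar that by blast
    ultimately show ?thesis unfolding flip_def by (cases "k \<in> B") auto
  qed
  then show ?thesis using clan_subset[OF assms(1)] unfolding clan_def by blast
qed

lemma clan_inversion_flip: "clan V f X \<Longrightarrow> clan_inversion V f (flip X f)"
  unfolding clan_inversion_def using agree_on_refl by blast

lemma clan_inversion_if_agree_on: "agree_on V f g \<Longrightarrow> clan_inversion V f g"
  unfolding clan_inversion_def clan_def agree_on_def flip_def by force

lemma skew_on_agree_on: "skew_on V s \<Longrightarrow> agree_on V s' s \<Longrightarrow> skew_on V s'"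
  unfolding skew_on_def agree_on_def by metis

lemma skew_on_flip:
  assumes "skew_on V s"
  shows "skew_on V (flip X s)"
proof -
  have "flip X s j i = - flip X s i j" if "i \<in> V" "j \<in> V" for i j
    using skew_onD[OF assms that] unfolding flip_def by simp
  then show ?thesis unfolding skew_on_def by blast
qed

lemma minors_agree_agree_on: "agree_on V s s' \<Longrightarrow> minors_agree V s s'"
  unfolding minors_agree_def agree_on_def pfaffian_def by simp

lemma minors_agree_flip:
  assumes s: "skew_on V s" and clan: "clan V s X"
  shows "minors_agree V s (flip X s)"
proof -
  define w where "w k = s (SOME x. x \<in> X) k" for k
  have row: "s i k = w k" and col: "s k i = - w k" if "i \<in> X" "k \<in> V" "k \<notin> X" for i k
  proof -
    have "(SOME x. x \<in> X) \<in> X" using that(1) by (rule someI)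
    then show "s i k = w k" unfolding w_def using clan that unfolding clan_def by blast
    then show "s k i = - w k" using skew_onD[OF s, of i k] clan_subset[OF clan] that by auto
  qed
  have flip: "flip X s i j = (if i \<in> X \<and> j \<in> X then - s i j else s i j)" if "i \<in> V" "j \<in> V" for i j
    unfolding flip_def using skew_onD[OF s that] by simp
  have "(s i j)\<^sup>2 = (flip X s i j)\<^sup>2" if "i \<in> V" "j \<in> V" for i j
    unfolding flip[OF that] by simp
  moreover have "(s i j + s j k + s k i)\<^sup>2 = (flip X s i j + flip X s j k + flip X s k i)\<^sup>2"
    if V: "i \<in> V" "j \<in> V" "k \<in> V" for i j k
  proof -
    let ?c = "\<lambda>f. f i j + f j k + f k i"
    have "?c (flip X s) = ?c s \<or> ?c (flip X s) = - ?c s"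
      using V by (cases "i \<in> X"; cases "j \<in> X"; cases "k \<in> X"; simp add: flip row col)
    then show ?thesis by (metis power2_minus)
  qed
  moreover have "(pfaffian s i j k l)\<^sup>2 = (pfaffian (flip X s) i j k l)\<^sup>2"
    if V: "i \<in> V" "j \<in> V" "k \<in> V" "l \<in> V" for i j k l
  proof -
    have "pfaffian (flip X s) i j k l = pfaffian s i j k l \<or>
        pfaffian (flip X s) i j k l = - pfaffian s i j k l"
      unfolding pfaffian_def using V
      by (cases "i \<in> X"; cases "j \<in> X"; cases "k \<in> X"; cases "l \<in> X";
          simp add: flip row col algebra_simps)
    then show ?thesis by (metis power2_minus)
  qed
  ultimately show ?thesis unfolding minors_agree_def by blast
qed

lemma skew_pair_clan_inversions:
  assumes "(clan_inversion V)\<^sup>*\<^sup>* s u" and "skew_pair V s t"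
  shows "skew_pair V u t"
  using assms
proof (induction rule: rtranclp_induct)
  case (step u u')
  then interpret skew_pair V u t by blast
  obtain X where X: "clan V u X" "agree_on V u' (flip X u)"
    using step.hyps(2) unfolding clan_inversion_def by blast
  have "minors_agree V u' u"
    using minors_agree_agree_on[OF X(2)] minors_agree_flip[OF skew_s X(1)] minors_agree_sym
      minors_agree_trans by blast
  then show ?case
    using skew_on_agree_on[OF skew_on_flip[OF skew_s] X(2)] skew_t minors minors_agree_trans
    by unfold_locales
qed

definition flip_between :: "'a set \<Rightarrow> 'a set \<Rightarrow> ('a \<Rightarrow> 'a \<Rightarrow> 'b) \<Rightarrow> 'a \<Rightarrow> 'a \<Rightarrow> 'b" where
  "flip_between Y Z f = (\<lambda>i j. if i \<in> Y \<and> j \<in> Z \<or> i \<in> Z \<and> j \<in> Y then f j i else f i j)"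

lemma clan_inversions_flip_between:
  assumes clans: "clan V f Y" "clan V f Z" "clan V f (Y \<union> Z)" and disjoint: "Y \<inter> Z = {}"
  shows "(clan_inversion V)\<^sup>*\<^sup>* f (flip_between Y Z f)"
proof -
  let ?g = "flip (Y \<union> Z) f"
  let ?h = "flip Y ?g"
  have "clan V ?g Y" "clan V ?g Z" using clans by (auto intro: clan_flip)
  moreover from this have "clan V ?h Z" using disjoint by (auto intro: clan_flip)
  ultimately have "clan_inversion V f ?g" "clan_inversion V ?g ?h" "clan_inversion V ?h (flip Z ?h)"
    using clans(3) by (auto intro: clan_inversion_flip)
  then have "(clan_inversion V)\<^sup>*\<^sup>* f (flip Z ?h)" by simp
  moreover have "flip Z ?h = flip_between Y Z f"
    using disjoint unfolding flip_def flip_between_def by (intro ext) auto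
  ultimately show ?thesis by simp
qed

definition replace_block :: "'a set \<Rightarrow> ('a \<Rightarrow> 'a \<Rightarrow> 'b) \<Rightarrow> ('a \<Rightarrow> 'a \<Rightarrow> 'b) \<Rightarrow> 'a \<Rightarrow> 'a \<Rightarrow> 'b" where
  "replace_block X g f = (\<lambda>i j. if i \<in> X \<and> j \<in> X then g i j else f i j)"

lemma clan_replace_block:
  assumes "clan V f X"
  shows "clan V (replace_block X g f) X"
proof -
  have "replace_block X g f i k = f i k" "replace_block X g f k i = f k i" if "k \<notin> X" for i k
    using that unfolding replace_block_def by simp_all
  then show ?thesis using assms unfolding clan_def by (metis DiffD2)
qed

lemma clan_inversions_replace_block:
  assumes "(clan_inversion X)\<^sup>*\<^sup>* f g" and X: "clan V f X"
  shows "(clan_inversion V)\<^sup>*\<^sup>* f (replace_block X g f)"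
  using assms(1)
proof (induction rule: rtranclp_induct)
  case base
  have "replace_block X f f = f" unfolding replace_block_def by auto
  then show ?case by simp
next
  case (step g g')
  let ?h = "replace_block X g f"
  obtain Y where Y: "clan X g Y" "agree_on X g' (flip Y g)"
    using step.hyps(2) unfolding clan_inversion_def by blast
  have "agree_on X ?h g" unfolding agree_on_def replace_block_def by simp
  then have "clan V ?h Y"
    using clan_trans[OF clan_replace_block[OF X]] clan_agree_on[OF Y(1)] by blast
  moreover have "agree_on V (replace_block X g' f) (flip Y ?h)"
    using Y(2) clan_subset[OF Y(1)] unfolding agree_on_def replace_block_def flip_def by auto
  ultimately have "clan_inversion V ?h (replace_block X g' f)"
    unfolding clan_inversion_def by blast
  with step.IH show ?case by (metis rtranclp.rtrancl_into_rtrancl)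
qed

text \<open>The quotient of \<open>V\<close> by a clan \<open>X\<close> is represented by \<open>insert x (V - X)\<close> with \<open>x \<in> X\<close>.\<close>

lemma clan_of_quotient:
  assumes X: "clan V f X" and x: "x \<in> X" and Y: "clan (insert x (V - X)) f Y"
  shows "clan V f (if x \<in> Y then X \<union> Y else Y)" (is "clan V f ?Y")
proof -
  define r where "r i = (if i \<in> X then x else i)" for i
  have X_to_x: "f i k = f x k" "f k i = f k x" if "i \<in> X" "k \<in> V - X" for i k
    using X x that unfolding clan_def by blast+
  have r: "f i k = f (r i) (r k)" if "i \<in> V" "k \<in> V" "\<not> (i \<in> X \<and> k \<in> X)" for i k
    using X_to_x(1)[of i k] X_to_x(2)[of k i] that unfolding r_def
    by (cases "i \<in> X"; cases "k \<in> X") simp_all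
  have XV: "X \<subseteq> V" and YV: "Y \<subseteq> insert x (V - X)" using clan_subset X Y by blast+
  have r_in: "r i \<in> insert x (V - X)" if "i \<in> V" for i using that unfolding r_def by auto
  have r_Y: "r i \<in> Y \<longleftrightarrow> i \<in> ?Y" if "i \<in> V" for i using that YV x unfolding r_def by auto
  have blow_up_subset: "?Y \<subseteq> V" using XV YV x by auto
  have "f i k = f j k \<and> f k i = f k j" if i: "i \<in> ?Y" and j: "j \<in> ?Y" and k: "k \<in> V - ?Y" for i j k
  proof -
    have in_V: "i \<in> V" "j \<in> V" "k \<in> V" using i j k blow_up_subset by blast+
    have "\<not> (p \<in> X \<and> k \<in> X)" if "p \<in> ?Y" for p
      using that k YV x by (auto split: if_splits)
    then have "f i k = f (r i) (r k)" "f j k = f (r j) (r k)"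
        "f k i = f (r k) (r i)" "f k j = f (r k) (r j)"
      using r i j in_V by blast+
    moreover have "f (r i) (r k) = f (r j) (r k) \<and> f (r k) (r i) = f (r k) (r j)"
      using Y r_Y r_in i j k in_V unfolding clan_def by blast
    ultimately show ?thesis by simp
  qed
  then show ?thesis using blow_up_subset unfolding clan_def by blast
qed

lemma clan_inversions_lift_quotient:
  assumes "(clan_inversion (insert x (V - X)))\<^sup>*\<^sup>* f g" and X: "clan V f X" and x: "x \<in> X"
  shows "\<exists>h. (clan_inversion V)\<^sup>*\<^sup>* f h \<and> clan V h X \<and> agree_on (insert x (V - X)) h g"
  using assms(1)
proof (induction rule: rtranclp_induct)
  case base
  then show ?case using X agree_on_refl by blast
next
  case (step g g')
  let ?W = "insert x (V - X)"
  obtain h where h: "(clan_inversion V)\<^sup>*\<^sup>* f h" "clan V h X" "agree_on ?W h g"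
    using step.IH by blast
  obtain Y where Y: "clan ?W g Y" "agree_on ?W g' (flip Y g)"
    using step.hyps(2) unfolding clan_inversion_def by blast
  define Y' where "Y' = (if x \<in> Y then X \<union> Y else Y)"
  have YW: "Y \<subseteq> ?W" using clan_subset Y(1) by blast
  have "clan V h Y'"
    unfolding Y'_def using clan_of_quotient[OF h(2) x] clan_agree_on[OF Y(1) h(3)] by blast
  then have "(clan_inversion V)\<^sup>*\<^sup>* f (flip Y' h)"
    using h(1) clan_inversion_flip by (metis rtranclp.rtrancl_into_rtrancl)
  moreover have "clan V (flip Y' h) X"
    using YW x by (intro clan_flip[OF h(2)]) (auto simp: Y'_def)
  moreover have "agree_on ?W (flip Y' h) (flip Y h)"
    using YW x unfolding Y'_def agree_on_def flip_def by auto
  then have "agree_on ?W (flip Y' h) g'"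
    using agree_on_flip[OF h(3), of Y] Y(2) unfolding agree_on_def by simp
  ultimately show ?case by blast
qed

section \<open>Reaching one skew function from another\<close>

definition indecomposable :: "'a set \<Rightarrow> ('a \<Rightarrow> 'a \<Rightarrow> 'b) \<Rightarrow> bool" where
  "indecomposable V f \<longleftrightarrow> (\<forall>X. clan V f X \<longrightarrow> 2 \<le> card X \<longrightarrow> X = V)"

lemma card_le_2_if_indecomposable_has_cut:
  assumes "finite V" "skew_on V s" "indecomposable V s" "has_cut V s a"
  shows "card V \<le> 2"
proof -
  obtain P where P: "P \<subset> V" "P \<noteq> {}" "\<forall>p\<in>P. \<forall>q\<in>V - P. s p q = a"
    using assms(4) by (rule has_cutE)
  then have "clan V s P" "clan V s (V - P)" "P \<noteq> V" "V - P \<noteq> V"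
    using clan_if_cut[OF assms(2), of P a] by blast+
  then have "\<not> 2 \<le> card P" "\<not> 2 \<le> card (V - P)"
    using assms(3) unfolding indecomposable_def by blast+
  moreover have "card V = card P + card (V - P)"
    using P(1) assms(1)
    by (metis card_Diff_subset card_mono finite_subset le_add_diff_inverse psubsetE)
  ultimately show ?thesis by simp
qed

lemma (in skew_pair) reversed_connected_if_indecomposable:
  assumes fin: "finite V" and indecomposable: "indecomposable V s"
    and ij: "i \<in> V" "j \<in> V" "reversed i j"
  shows "connected_on V reversed"
proof -
  have "symp_on V reversed" using reversed_sym by (intro symp_onI) blast
  then obtain C where C: "i \<in> C" "C \<subseteq> V" "connected_on C reversed"
      "\<And>c y. c \<in> C \<Longrightarrow> y \<in> V - C \<Longrightarrow> \<not> reversed c y"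
    using connected_component_exists[OF fin _ ij(1)] by metis
  have "j \<in> C" using C(1,4) ij by blast
  moreover have "i \<noteq> j" using reversed_nonzero[OF ij] skew_on_diagonal[OF skew_s ij(1)] by auto
  moreover have "finite C" using C(2) fin finite_subset by blast
  ultimately have "2 \<le> card C" using card_mono[of C "{i, j}"] C(1) by simp
  then have "C = V"
    using clan_if_reversed_component[OF C(2-4)] indecomposable unfolding indecomposable_def by blast
  then show ?thesis using C(3) by simp
qed

lemma (in skew_pair) agree_on_if_indecomposable:
  assumes fin: "finite V" and indecomposable: "indecomposable V s"
  shows "agree_on V s t \<or> agree_on V s (neg t)"
proof (rule ccontr)
  assume "\<not> ?thesis"
  then obtain i j k l where ij: "i \<in> V" "j \<in> V" "reversed i j" and kl: "k \<in> V" "l \<in> V" "kept k l"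
    unfolding agree_on_def differ_def by blast
  interpret neg: skew_pair V s "neg t" by (rule neg)
  have connected: "connected_on V reversed" "connected_on V kept"
    using reversed_connected_if_indecomposable[OF assms ij]
      neg.reversed_connected_if_indecomposable[OF assms kl] by blast+
  have "i \<noteq> j" using reversed_nonzero[OF ij] skew_on_diagonal[OF skew_s ij(1)] by auto
  then have "2 \<le> card V" using card_mono[of V "{i, j}"] fin ij by simp
  then have "4 \<le> card V" "\<exists>a. has_cut V s a"
    using four_le_card_if_both_connected[OF fin _ connected]
      nonzero_cut_if_both_connected[OF skew_pair_axioms fin _ connected] by blast+
  then show False
    using card_le_2_if_indecomposable_has_cut[OF fin skew_s indecomposable] by fastforce
qed

lemma (in skew_pair) clan_inversions_if_indecomposable:
  assumes "finite V" "indecomposable V s"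
  shows "(clan_inversion V)\<^sup>*\<^sup>* s t"
proof (cases "agree_on V s t")
  case True
  then show ?thesis using clan_inversion_if_agree_on by blast
next
  case False
  then have "agree_on V s (neg t)" using agree_on_if_indecomposable assms by blast
  then have "t i j = flip V s i j" if "i \<in> V" "j \<in> V" for i j
    using skew_onD[OF skew_t that] that unfolding agree_on_def flip_def by simp
  then have "agree_on V t (flip V s)" unfolding agree_on_def by blast
  moreover have "clan V s V" unfolding clan_def by blast
  ultimately show ?thesis unfolding clan_inversion_def by blast
qed

lemma (in skew_pair) clan_Un_reversed_neighbours:
  assumes X: "clan V s X" and z: "z \<in> X"
    and outside: "\<And>i j. i \<in> V - X \<Longrightarrow> j \<in> V - X \<Longrightarrow> \<not> reversed i j"
  shows "clan V s (X \<union> {y \<in> V - X. reversed z y})" (is "clan V s (X \<union> ?R)")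
proof (rule clanI_skew_on[OF skew_s])
  have XV: "X \<subseteq> V" by (rule clan_subset[OF X])
  then show "X \<union> ?R \<subseteq> V" by blast
  fix i j k assume ij: "i \<in> X \<union> ?R" "j \<in> X \<union> ?R" and k: "k \<in> V - (X \<union> ?R)"
  have "s p k = s z k" if "p \<in> X \<union> ?R" for p
  proof (cases "p \<in> X")
    case True
    then show ?thesis using X z k unfolding clan_def by blast
  next
    case False
    then show ?thesis using reversed_triangle[of z p k] outside[of p k] that k z XV by auto
  qed
  then show "s i k = s j k" using ij by metis
qed

text \<open>With these clans, \<open>flip_between\<close> undoes a rectangle \<open>Z \<times> (V - X)\<close> of reversed pairs.\<close>

lemma (in skew_pair) clans_if_reversed_rectangle:
  assumes X: "clan V s X" and Z: "Z \<subset> X" "Z \<noteq> {}" and Y: "Y = V - X" "Y \<noteq> {}"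
    and reversed_iff: "\<And>i j. i \<in> V \<Longrightarrow> j \<in> V \<Longrightarrow> reversed i j \<longleftrightarrow> i \<in> Z \<and> j \<in> Y \<or> i \<in> Y \<and> j \<in> Z"
  shows "clan V s Y" "clan V s Z" "clan V s (Y \<union> Z)"
proof -
  have XV: "X \<subseteq> V" by (rule clan_subset[OF X])
  obtain z\<^sub>0 y\<^sub>0 where z\<^sub>0: "z\<^sub>0 \<in> Z" and y\<^sub>0: "y\<^sub>0 \<in> Y" using Z(2) Y(2) by blast
  have across: "s z p = s y p" if "z \<in> Z" "y \<in> Y" "p \<in> X - Z" for z y p
    using reversed_triangle[of z y p] reversed_iff that XV Z(1) Y(1) by blast
  have row: "s i p = s y\<^sub>0 p" if "i \<in> Y \<union> Z" "p \<in> X - Z" for i p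
    using across[of i y\<^sub>0 p] across[of z\<^sub>0 i p] across[of z\<^sub>0 y\<^sub>0 p] that z\<^sub>0 y\<^sub>0 by auto
  have col: "s p i = s q i" if "p \<in> X" "q \<in> X" "i \<in> Y" for p q i
    using X that unfolding clan_def Y(1) by blast
  show "clan V s (Y \<union> Z)"
  proof (rule clanI_skew_on[OF skew_s])
    fix i j k assume "i \<in> Y \<union> Z" "j \<in> Y \<union> Z" "k \<in> V - (Y \<union> Z)"
    then show "s i k = s j k" using row[of i k] row[of j k] Y(1) by auto
  qed (use XV Z(1) Y(1) in blast)
  show "clan V s Z"
  proof (rule clanI_skew_on[OF skew_s])
    fix i j k assume "i \<in> Z" "j \<in> Z" "k \<in> V - Z"
    then show "s i k = s j k"
      using row[of i k] row[of j k] col[of i j k] Z(1) Y(1) by (cases "k \<in> X") auto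
  qed (use XV Z(1) in blast)
  show "clan V s Y"
  proof (rule clanI_skew_on[OF skew_s])
    fix i j k assume ij: "i \<in> Y" "j \<in> Y" and k: "k \<in> V - Y"
    obtain p where p: "p \<in> X - Z" using Z(1) by blast
    have "s v k = s y\<^sub>0 p" if "v \<in> Y" for v
    proof -
      have "s k v = s p v" using col[of k p v] that p k Y(1) by blast
      then have "s v k = s v p"
        using skew_onD[OF skew_s, of k v] skew_onD[OF skew_s, of p v] that p k XV Y(1) by auto
      then show ?thesis using row[of v p] that p by simp
    qed
    then show "s i k = s j k" using ij by metis
  qed (use Y(1) in blast)
qed

lemma (in skew_pair) clan_inversions_if_agree_on_maximal_clan_and_quotient:
  assumes X: "clan V s X" "X \<noteq> V" "x \<in> X"
    and maximal: "\<And>X'. clan V s X' \<Longrightarrow> X \<subset> X' \<Longrightarrow> X' = V"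
    and agree: "agree_on X s t" "agree_on (insert x (V - X)) s t"
  shows "(clan_inversion V)\<^sup>*\<^sup>* s t"
proof -
  define Y where "Y = V - X"
  define Z where "Z = {z \<in> X. \<exists>y\<in>Y. reversed z y}"
  have XV: "X \<subseteq> V" by (rule clan_subset[OF X(1)])
  have not_reversed: "\<not> reversed i j" if "i \<in> X \<and> j \<in> X \<or> i \<in> insert x Y \<and> j \<in> insert x Y" for i j
    using that agree unfolding differ_def agree_on_def Y_def by blast
  have rectangle: "reversed z y" if "z \<in> Z" "y \<in> Y" for z y
  proof -
    have "clan V s (X \<union> {y \<in> V - X. reversed z y})"
      using clan_Un_reversed_neighbours[OF X(1)] that(1) not_reversed unfolding Z_def Y_def by blast
    moreover have "X \<subset> X \<union> {y \<in> V - X. reversed z y}" using that(1) unfolding Z_def Y_def by blast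
    ultimately show ?thesis using maximal that(2) unfolding Y_def by blast
  qed
  have reversed_iff: "reversed i j \<longleftrightarrow> i \<in> Z \<and> j \<in> Y \<or> i \<in> Y \<and> j \<in> Z" if "i \<in> V" "j \<in> V" for i j
    using rectangle[of i j] rectangle[of j i] not_reversed[of i j] reversed_sym[OF that] that
    unfolding Z_def Y_def by blast
  have "(clan_inversion V)\<^sup>*\<^sup>* s (flip_between Y Z s)"
  proof (cases "Z = {}")
    case True
    then show ?thesis unfolding flip_between_def by simp
  next
    case False
    have "x \<notin> Z" using not_reversed unfolding Z_def by blast
    then have "Z \<subset> X" using X(3) unfolding Z_def by blast
    then show ?thesis
      using clans_if_reversed_rectangle[OF X(1) _ False Y_def _ reversed_iff] X(2) XV
        clan_inversions_flip_between[of V s Y Z] unfolding Y_def by blast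
  qed
  moreover have "agree_on V (flip_between Y Z s) t"
  proof -
    have "flip_between Y Z s i j = t i j" if "i \<in> V" "j \<in> V" for i j
      using reversed_iff[OF that] reversed_uminus[OF that] skew_onD[OF skew_s that]
      unfolding flip_between_def differ_def by auto
    then show ?thesis unfolding agree_on_def by blast
  qed
  ultimately show ?thesis
    using clan_inversion_if_agree_on by (metis rtranclp.rtrancl_into_rtrancl)
qed

lemma (in skew_pair) clan_inversions_to_agree_on_clan_and_quotient:
  assumes X: "clan V s X" "x \<in> X"
    and reach_quotient: "(clan_inversion (insert x (V - X)))\<^sup>*\<^sup>* s t"
    and reach_clan: "\<And>u. skew_pair X u t \<Longrightarrow> (clan_inversion X)\<^sup>*\<^sup>* u t"
  shows "\<exists>u. (clan_inversion V)\<^sup>*\<^sup>* s u \<and> clan V u X \<and>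
    agree_on X u t \<and> agree_on (insert x (V - X)) u t"
proof -
  obtain u where u: "(clan_inversion V)\<^sup>*\<^sup>* s u" "clan V u X" "agree_on (insert x (V - X)) u t"
    using clan_inversions_lift_quotient[OF reach_quotient X] by blast
  interpret u: skew_pair V u t by (rule skew_pair_clan_inversions[OF u(1) skew_pair_axioms])
  let ?u = "replace_block X t u"
  have "(clan_inversion X)\<^sup>*\<^sup>* u t" by (rule reach_clan[OF u.subset[OF clan_subset[OF u(2)]]])
  then have "(clan_inversion V)\<^sup>*\<^sup>* s ?u"
    using u(1) clan_inversions_replace_block[OF _ u(2)] by (meson rtranclp_trans)
  moreover have "agree_on X ?u t" "agree_on (insert x (V - X)) ?u t"
    using u(3) unfolding agree_on_def replace_block_def by auto
  ultimately show ?thesis using clan_replace_block[OF u(2)] by blast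
qed

lemma maximal_reachable_clan_exists:
  assumes fin: "finite V" and "\<not> indecomposable V f"
  obtains g X where "(clan_inversion V)\<^sup>*\<^sup>* f g" "clan V g X" "X \<noteq> V" "2 \<le> card X"
    "\<And>h X'. (clan_inversion V)\<^sup>*\<^sup>* f h \<Longrightarrow> clan V h X' \<Longrightarrow> X \<subset> X' \<Longrightarrow> X' = V"
proof -
  define clans where "clans = {X. X \<noteq> V \<and> 2 \<le> card X \<and> (\<exists>g. (clan_inversion V)\<^sup>*\<^sup>* f g \<and> clan V g X)}"
  have "clans \<noteq> {}" using assms(2) unfolding clans_def indecomposable_def by blast
  moreover have "clans \<subseteq> Pow V" unfolding clans_def using clan_subset by blast
  then have "finite clans" using fin finite_subset by blast
  ultimately obtain X where "X \<in> clans" and maximal: "\<forall>X'\<in>clans. X \<subseteq> X' \<longrightarrow> X = X'"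
    using finite_has_maximal by metis
  then obtain g where g: "(clan_inversion V)\<^sup>*\<^sup>* f g" "clan V g X" "X \<noteq> V" "2 \<le> card X"
    unfolding clans_def by blast
  have "X' = V" if "(clan_inversion V)\<^sup>*\<^sup>* f h" "clan V h X'" "X \<subset> X'" for h X'
  proof (rule ccontr)
    assume "X' \<noteq> V"
    moreover have "finite X'" using clan_subset[OF that(2)] fin finite_subset by blast
    then have "2 \<le> card X'"
      using g(4) card_mono[of X' X] that(3) by (meson le_trans psubset_imp_subset)
    ultimately show False using maximal that unfolding clans_def by blast
  qed
  then show thesis by (rule that[OF g])
qed

theorem clan_inversions_if_skew_pair:
  assumes "finite V" "skew_pair V s t"
  shows "(clan_inversion V)\<^sup>*\<^sup>* s t"
  using assms
proof (induction V arbitrary: s rule: finite_psubset_induct)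
  case (psubset V)
  show ?case
  proof (cases "indecomposable V s")
    case True
    then show ?thesis using skew_pair.clan_inversions_if_indecomposable psubset by blast
  next
    case False
    then obtain u X where u: "(clan_inversion V)\<^sup>*\<^sup>* s u" and X: "clan V u X" "X \<noteq> V" "2 \<le> card X"
      and maximal: "\<And>v X'. (clan_inversion V)\<^sup>*\<^sup>* s v \<Longrightarrow> clan V v X' \<Longrightarrow> X \<subset> X' \<Longrightarrow> X' = V"
      using maximal_reachable_clan_exists[OF psubset.hyps] by metis
    interpret u: skew_pair V u t by (rule skew_pair_clan_inversions[OF u psubset.prems])
    obtain x where x: "x \<in> X" using X(3) by fastforce
    have "X \<noteq> {x}" using X(3) by auto
    then have proper: "X \<subset> V" "insert x (V - X) \<subset> V" using clan_subset[OF X(1)] X(2) x by blast+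
    then have "(clan_inversion (insert x (V - X)))\<^sup>*\<^sup>* u t"
      using psubset.IH u.subset by blast
    then obtain v where v: "(clan_inversion V)\<^sup>*\<^sup>* u v" "clan V v X"
        "agree_on X v t" "agree_on (insert x (V - X)) v t"
      using u.clan_inversions_to_agree_on_clan_and_quotient[OF X(1) x] psubset.IH[OF proper(1)]
      by blast
    interpret v: skew_pair V v t by (rule skew_pair_clan_inversions[OF v(1) u.skew_pair_axioms])
    have sv: "(clan_inversion V)\<^sup>*\<^sup>* s v" using u v(1) by simp
    then have "(clan_inversion V)\<^sup>*\<^sup>* v t"
      using v.clan_inversions_if_agree_on_maximal_clan_and_quotient[OF v(2) X(2) x _ v(3,4)] maximal
      by blast
    with sv show ?thesis by (rule rtranclp_trans)
  qed
qed

section \<open>Determinants\<close>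

lemma det_four_block_mat_schur:
  fixes P :: "'a :: idom mat"
  assumes P: "P \<in> carrier_mat r r" and W: "W \<in> carrier_mat r m"
    and Z: "Z \<in> carrier_mat m r" and Q: "Q \<in> carrier_mat m m"
  shows "det Q ^ r * det (four_block_mat P W Z Q) =
    det (det Q \<cdot>\<^sub>m P - W * (adj_mat Q * Z)) * det Q"
proof -
  note adj = adj_mat[OF Q]
  let ?S = "det Q \<cdot>\<^sub>m P - W * (adj_mat Q * Z)"
  let ?L = "four_block_mat (det Q \<cdot>\<^sub>m 1\<^sub>m r) (- (W * adj_mat Q)) (0\<^sub>m m r) (1\<^sub>m m)"
  have "W * adj_mat Q * Z = W * (adj_mat Q * Z)"
    using assoc_mult_mat[OF W adj(1) Z] .
  moreover have "W * adj_mat Q * Q = det Q \<cdot>\<^sub>m W"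
    using assoc_mult_mat[OF W adj(1) Q] adj(3) W mult_smult_distrib[OF W one_carrier_mat] by simp
  ultimately have "?L * four_block_mat P W Z Q = four_block_mat ?S (0\<^sub>m r m) Z Q"
    using P W Z Q adj(1)
    by (subst mult_four_block_mat[of _ r r _ m _ m _ _ r _ m]) (auto intro!: cong_four_block_mat)
  moreover have "det ?L = det Q ^ r"
    using W adj(1) by (subst det_four_block_mat_lower_left_zero[of _ r _ m]) auto
  moreover have "det (?L * four_block_mat P W Z Q) = det ?L * det (four_block_mat P W Z Q)"
    by (rule det_mult[of _ "r + m"]) (use P W Q adj(1) in auto)
  moreover have "det (four_block_mat ?S (0\<^sub>m r m) Z Q) = det ?S * det Q"
    by (rule det_four_block_mat_upper_right_zero[of _ r _ m]) (use P W Z Q adj(1) in auto)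
  ultimately show ?thesis by simp
qed

lemma det_four_block_mat_transpose_nonsingular:
  fixes P :: "'a :: idom mat"
  assumes P: "P \<in> carrier_mat r r" and W: "W \<in> carrier_mat r m"
    and Z: "Z \<in> carrier_mat m r" and Q: "Q \<in> carrier_mat m m"
    and rows: "\<And>i. i < r \<Longrightarrow> row W i = w" and cols: "\<And>j. j < r \<Longrightarrow> col Z j = z"
    and det_Q: "det Q \<noteq> 0"
  shows "det (four_block_mat P\<^sup>T W Z Q) = det (four_block_mat P W Z Q)"
proof -
  define K where "K = W * (adj_mat Q * Z)"
  note adj = adj_mat(1)[OF Q]
  have K: "K \<in> carrier_mat r r" unfolding K_def using W Z adj by simp
  have K_sym: "K $$ (i,j) = K $$ (j,i)" if "i < r" "j < r" for i j
    using that W Z adj rows cols by (simp add: K_def col_mult2[of _ m m _ r])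
  have "det Q \<cdot>\<^sub>m P\<^sup>T - K = (det Q \<cdot>\<^sub>m P - K)\<^sup>T"
    using P K K_sym by (intro eq_matI) auto
  then have "det (det Q \<cdot>\<^sub>m P\<^sup>T - K) = det (det Q \<cdot>\<^sub>m P - K)"
    using det_transpose[OF minus_carrier_mat[OF K]] by simp
  then have "det Q ^ r * det (four_block_mat P\<^sup>T W Z Q) = det Q ^ r * det (four_block_mat P W Z Q)"
    using det_four_block_mat_schur[OF _ W Z Q] P by (simp add: K_def)
  then show ?thesis using det_Q by simp
qed

text \<open>Adding an indeterminate to the diagonal of \<open>Q\<close> makes it nonsingular over the polynomial ring.\<close>

lemma det_four_block_mat_transpose:
  fixes P :: "'a :: idom mat"
  assumes P: "P \<in> carrier_mat r r" and W: "W \<in> carrier_mat r m"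
    and Z: "Z \<in> carrier_mat m r" and Q: "Q \<in> carrier_mat m m"
    and rows: "\<And>i. i < r \<Longrightarrow> row W i = w" and cols: "\<And>j. j < r \<Longrightarrow> col Z j = z"
  shows "det (four_block_mat P\<^sup>T W Z Q) = det (four_block_mat P W Z Q)"
proof -
  let ?C = "map_mat (\<lambda>a. [:a:])"
  let ?B = "\<lambda>R. four_block_mat (?C R) (?C W) (?C Z) (char_poly_matrix (- Q))"
  have eval: "poly (det (?B R)) 0 = det (four_block_mat R W Z Q)" if "R \<in> carrier_mat r r" for R
    by (rule poly_det_cong[of _ "r + m"])
      (use that P W Z Q in \<open>auto simp: char_poly_matrix_def\<close>)
  have "char_poly (- Q) \<noteq> 0"
    using degree_monic_char_poly[of "- Q" m] Q by auto
  moreover have "row (?C W) i = map_vec (\<lambda>a. [:a:]) w" if "i < r" for i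
    using rows[OF that] that W by auto
  moreover have "col (?C Z) j = map_vec (\<lambda>a. [:a:]) z" if "j < r" for j
    using cols[OF that] that Z by auto
  ultimately have "det (?B P\<^sup>T) = det (?B P)"
    using P W Z Q det_four_block_mat_transpose_nonsingular[of "?C P" r "?C W" m "?C Z"
      "char_poly_matrix (- Q)" "map_vec (\<lambda>a. [:a:]) w" "map_vec (\<lambda>a. [:a:]) z"]
    by (simp add: char_poly_def map_mat_transpose)
  then show ?thesis using eval[of P] eval[of "P\<^sup>T"] P by simp
qed

lemma det_permute_rows_cols:
  fixes A :: "'a :: comm_ring_1 mat"
  assumes A: "A \<in> carrier_mat n n" and p: "p permutes {0..<n}"
  shows "det (mat n n (\<lambda>(i,j). A $$ (p i, p j))) = det A"
proof -
  have p_less: "p i < n" if "i < n" for i using permutes_in_image[OF p, of i] that by simp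
  let ?B = "mat n n (\<lambda>(i,j). A\<^sup>T $$ (p i, j))"
  have "mat n n (\<lambda>(i,j). A $$ (p i, p j)) = mat n n (\<lambda>(i,j). ?B\<^sup>T $$ (p i, j))"
    using A p_less by (intro eq_matI) auto
  then have "det (mat n n (\<lambda>(i,j). A $$ (p i, p j))) = signof p * det (?B\<^sup>T)"
    using det_permute_rows[OF _ p, of "?B\<^sup>T"] by simp
  also have "det (?B\<^sup>T) = signof p * det A"
    using det_permute_rows[OF _ p, of "A\<^sup>T"] det_transpose[of ?B n] det_transpose[OF A] A by simp
  finally show ?thesis by (cases p rule: sign_cases) simp_all
qed

lemma bij_betw_pick:
  assumes "finite X"
  shows "bij_betw (pick X) {..<card X} X"
proof -
  have inj: "inj_on (pick X) {..<card X}"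
    by (rule inj_onI) (metis lessThan_iff linorder_neqE_nat nat_less_le pick_mono_le)
  moreover have "pick X ` {..<card X} \<subseteq> X" using pick_in_set_le by auto
  ultimately show ?thesis
    unfolding bij_betw_def using card_subset_eq[OF assms] card_image[OF inj] by simp
qed

lemma det_principal_submatrix_list:
  fixes M :: "'a :: comm_ring_1 mat"
  assumes M: "M \<in> carrier_mat n n" and xs: "distinct xs" "set xs \<subseteq> {..<n}"
  shows "det (principal_submatrix M (set xs)) =
    det (mat (length xs) (length xs) (\<lambda>(i,j). M $$ (xs ! i, xs ! j)))"
proof -
  let ?k = "length xs" and ?A = "mat (length xs) (length xs) (\<lambda>(i,j). M $$ (xs ! i, xs ! j))"
  have pick: "bij_betw (pick (set xs)) {..<?k} (set xs)"
    using bij_betw_pick[of "set xs"] distinct_card[OF xs(1)] by simp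
  have nth: "bij_betw ((!) xs) {..<?k} (set xs)" using bij_betw_nth[OF xs(1)] by simp
  define p where "p i = (if i < ?k then inv_into {..<?k} ((!) xs) (pick (set xs) i) else i)" for i
  have "bij_betw (inv_into {..<?k} ((!) xs) \<circ> pick (set xs)) {..<?k} {..<?k}"
    using bij_betw_trans[OF pick bij_betw_inv_into[OF nth]] .
  then have bij_p: "bij_betw p {..<?k} {..<?k}"
    by (rule bij_betw_cong[THEN iffD1, rotated]) (simp add: p_def)
  then have p: "p permutes {0..<?k}"
    by (intro bij_imp_permutes) (auto simp: p_def atLeast0LessThan)
  have p_less: "p i < ?k" and nth_p: "xs ! p i = pick (set xs) i" if "i < ?k" for i
    using that bij_betwE[OF bij_p] bij_betwE[OF pick] bij_betw_inv_into_right[OF nth]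
    by (auto simp: p_def)
  have "{i. i < n \<and> i \<in> set xs} = set xs" using xs(2) by auto
  then have "principal_submatrix M (set xs) =
      mat ?k ?k (\<lambda>(i,j). M $$ (pick (set xs) i, pick (set xs) j))"
    using M distinct_card[OF xs(1)] unfolding principal_submatrix_def submatrix_def by simp
  also have "\<dots> = mat ?k ?k (\<lambda>(i,j). ?A $$ (p i, p j))"
    by (rule eq_matI) (simp_all add: p_less nth_p)
  finally show ?thesis using det_permute_rows_cols[of ?A ?k p] p by simp
qed

theorem det_principal_submatrix_Inv:
  fixes M :: "'a :: idom mat"
  assumes M: "M \<in> carrier_mat n n" and clan: "is_clan n M X" and Y: "Y \<subseteq> {..<n}"
  shows "det (principal_submatrix (Inv M X) Y) = det (principal_submatrix M Y)"
proof -
  have "finite Y" using Y finite_subset by blast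
  then obtain xs ys where xs: "set xs = Y \<inter> X" "distinct xs" and ys: "set ys = Y - X" "distinct ys"
    using finite_distinct_list by (metis finite_Diff finite_Int)
  define zs where "zs = xs @ ys"
  have zs: "distinct zs" "set zs = Y" unfolding zs_def using xs ys by auto
  define r m where "r = length xs" and "m = length ys"
  have x: "xs ! i \<in> X" "xs ! i < n" if "i < r" for i
    using that nth_mem[of i xs] xs(1) Y unfolding r_def by auto
  have y: "ys ! i \<notin> X" "ys ! i < n" if "i < m" for i
    using that nth_mem[of i ys] ys(1) Y unfolding m_def by auto
  define P where "P = mat r r (\<lambda>(i,j). M $$ (xs ! i, xs ! j))"
  define W where "W = mat r m (\<lambda>(i,j). M $$ (xs ! i, ys ! j))"
  define Z where "Z = mat m r (\<lambda>(i,j). M $$ (ys ! i, xs ! j))"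
  define Q where "Q = mat m m (\<lambda>(i,j). M $$ (ys ! i, ys ! j))"
  note blocks = P_def W_def Z_def Q_def
  have minor: "det (principal_submatrix N Y) =
      det (mat (r + m) (r + m) (\<lambda>(i,j). N $$ (zs ! i, zs ! j)))"
    if "N \<in> carrier_mat n n" for N :: "'a mat"
    using det_principal_submatrix_list[OF that zs(1)] zs(2) Y unfolding zs_def r_def m_def by auto
  have "mat (r + m) (r + m) (\<lambda>(i,j). M $$ (zs ! i, zs ! j)) = four_block_mat P W Z Q"
    by (rule eq_matI) (auto simp: blocks zs_def nth_append r_def[symmetric])
  moreover have "mat (r + m) (r + m) (\<lambda>(i,j). Inv M X $$ (zs ! i, zs ! j)) =
      four_block_mat P\<^sup>T W Z Q"
    using M x y by (intro eq_matI) (auto simp: blocks Inv_def zs_def nth_append r_def[symmetric])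
  moreover have "det (four_block_mat P\<^sup>T W Z Q) = det (four_block_mat P W Z Q)"
  proof (rule det_four_block_mat_transpose)
    show "row W i = row W 0" if "i < r" for i
      using that clan x y unfolding W_def is_clan_def by (intro eq_vecI) auto
    show "col Z j = col Z 0" if "j < r" for j
      using that clan x y unfolding Z_def is_clan_def by (intro eq_vecI) auto
  qed (auto simp: blocks)
  moreover have "Inv M X \<in> carrier_mat n n" using M unfolding Inv_def by auto
  ultimately show ?thesis using minor M by simp
qed

lemma det_mat_Suc:
  fixes a :: "nat \<Rightarrow> nat \<Rightarrow> 'a :: comm_ring_1"
  shows "det (mat (Suc n) (Suc n) (\<lambda>(i,j). a i j)) =
    (\<Sum>j<Suc n. (-1) ^ j * a 0 j * det (mat n n (\<lambda>(i,k). a (Suc i) (if k < j then k else Suc k))))"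
proof -
  let ?A = "mat (Suc n) (Suc n) (\<lambda>(i,j). a i j)"
  have "mat_delete ?A 0 j = mat n n (\<lambda>(i,k). a (Suc i) (if k < j then k else Suc k))" for j
    unfolding mat_delete_def by (rule eq_matI) auto
  then have "?A $$ (0,j) * cofactor ?A 0 j =
      (-1) ^ j * a 0 j * det (mat n n (\<lambda>(i,k). a (Suc i) (if k < j then k else Suc k)))"
    if "j < Suc n" for j
    using that unfolding cofactor_def by (simp add: mult_ac)
  then show ?thesis using laplace_expansion_row[of ?A "Suc n" 0] by simp
qed

lemma det_mat_2:
  fixes a :: "nat \<Rightarrow> nat \<Rightarrow> 'a :: comm_ring_1"
  shows "det (mat 2 2 (\<lambda>(i,j). a i j)) = a 0 0 * a 1 1 - a 0 1 * a 1 0"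
  unfolding numeral_2_eq_2 by (simp add: det_mat_Suc)

lemma det_mat_3:
  fixes a :: "nat \<Rightarrow> nat \<Rightarrow> 'a :: comm_ring_1"
  shows "det (mat 3 3 (\<lambda>(i,j). a i j)) =
    a 0 0 * (a 1 1 * a 2 2 - a 1 2 * a 2 1) - a 0 1 * (a 1 0 * a 2 2 - a 1 2 * a 2 0)
    + a 0 2 * (a 1 0 * a 2 1 - a 1 1 * a 2 0)"
  unfolding numeral_3_eq_3 numeral_2_eq_2[symmetric] det_mat_Suc det_mat_2
  by (simp add: numeral_2_eq_2)

lemma det_mat_4:
  fixes a :: "nat \<Rightarrow> nat \<Rightarrow> 'a :: comm_ring_1"
  shows "det (mat 4 4 (\<lambda>(i,j). a i j)) =
    a 0 0 * (a 1 1 * (a 2 2 * a 3 3 - a 2 3 * a 3 2) - a 1 2 * (a 2 1 * a 3 3 - a 2 3 * a 3 1)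
      + a 1 3 * (a 2 1 * a 3 2 - a 2 2 * a 3 1))
    - a 0 1 * (a 1 0 * (a 2 2 * a 3 3 - a 2 3 * a 3 2) - a 1 2 * (a 2 0 * a 3 3 - a 2 3 * a 3 0)
      + a 1 3 * (a 2 0 * a 3 2 - a 2 2 * a 3 0))
    + a 0 2 * (a 1 0 * (a 2 1 * a 3 3 - a 2 3 * a 3 1) - a 1 1 * (a 2 0 * a 3 3 - a 2 3 * a 3 0)
      + a 1 3 * (a 2 0 * a 3 1 - a 2 1 * a 3 0))
    - a 0 3 * (a 1 0 * (a 2 1 * a 3 2 - a 2 2 * a 3 1) - a 1 1 * (a 2 0 * a 3 2 - a 2 2 * a 3 0)
      + a 1 2 * (a 2 0 * a 3 1 - a 2 1 * a 3 0))"
proof -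
  have four: "(4::nat) = Suc 3" by simp
  show ?thesis
    unfolding four det_mat_Suc det_mat_3 by (simp add: numeral_2_eq_2 numeral_3_eq_3)
qed

section \<open>Generalized tournament matrices\<close>

definition skew_part :: "'a :: ab_group_add mat \<Rightarrow> nat \<Rightarrow> nat \<Rightarrow> 'a" where
  "skew_part M i j = M $$ (i,j) - M $$ (j,i)"

lemma skew_part_swap: "skew_part M j i = - skew_part M i j"
  unfolding skew_part_def by simp

lemma skew_on_skew_part: "skew_on V (skew_part M)"
  unfolding skew_on_def using skew_part_swap by blast

lemma gen_tournament_iff:
  "gen_tournament n M \<longleftrightarrow> M \<in> carrier_mat n n \<and>
     (\<forall>i<n. \<forall>j<n. M $$ (i,j) \<ge> 0 \<and> M $$ (i,j) + M $$ (j,i) = (if i = j then 0 else 1))"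
proof (cases "M \<in> carrier_mat n n")
  case True
  then have "M + M\<^sup>T = mat n n (\<lambda>_. 1) - 1\<^sub>m n \<longleftrightarrow>
      (\<forall>i<n. \<forall>j<n. M $$ (i,j) + M $$ (j,i) = (if i = j then 0 else 1))"
    by (subst mat_eq_iff) auto
  then show ?thesis unfolding gen_tournament_def by blast
qed (simp add: gen_tournament_def)

lemma gen_tournament_carrier: "gen_tournament n M \<Longrightarrow> M \<in> carrier_mat n n"
  unfolding gen_tournament_def by blast

lemma gen_tournament_entry:
  assumes "gen_tournament n M" "i < n" "j < n"
  shows "M $$ (i,j) = (if i = j then 0 else (1 + skew_part M i j) / 2)"
proof -
  have "M $$ (i,j) + M $$ (j,i) = (if i = j then 0 else 1)"
    using assms unfolding gen_tournament_iff by blast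
  then show ?thesis unfolding skew_part_def by (auto simp: field_simps)
qed

lemma det_principal_submatrix_gen_tournament:
  assumes M: "gen_tournament n M" and xs: "distinct xs" "set xs \<subseteq> {..<n}" and m: "length xs = m"
  shows "2 ^ m * det (principal_submatrix M (set xs)) =
    det (mat m m (\<lambda>(p,q). if p = q then 0 else 1 + skew_part M (xs ! p) (xs ! q)))"
proof -
  have in_n: "xs ! p < n" if "p < m" for p
    using that xs(2) m by (metis lessThan_iff nth_mem subsetD)
  have "mat m m (\<lambda>(p,q). if p = q then 0 else 1 + skew_part M (xs ! p) (xs ! q)) =
      2 \<cdot>\<^sub>m mat m m (\<lambda>(p,q). M $$ (xs ! p, xs ! q))"
    by (rule eq_matI) (auto simp: gen_tournament_entry[OF M] in_n nth_eq_iff_index_eq[OF xs(1)] m)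
  then show ?thesis
    by (simp only: det_principal_submatrix_list[OF gen_tournament_carrier[OF M] xs] m
        det_smult dim_col_mat)
qed

lemma principal_minor_2:
  assumes M: "gen_tournament n M" and ij: "distinct [i,j]" "set [i,j] \<subseteq> {..<n}"
  defines "s \<equiv> skew_part M"
  shows "4 * det (principal_submatrix M (set [i,j])) = (s i j)\<^sup>2 - 1"
  using det_principal_submatrix_gen_tournament[OF M ij, of 2]
  by (simp add: s_def det_mat_2 skew_part_swap[of M j i] power2_eq_square algebra_simps)

lemma principal_minor_3:
  assumes M: "gen_tournament n M" and ijk: "distinct [i,j,k]" "set [i,j,k] \<subseteq> {..<n}"
  defines "s \<equiv> skew_part M"
  shows "8 * det (principal_submatrix M (set [i,j,k])) =
    (s i j + s j k + s k i)\<^sup>2 - (s i j)\<^sup>2 - (s j k)\<^sup>2 - (s k i)\<^sup>2 + 2"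
  using det_principal_submatrix_gen_tournament[OF M ijk, of 3]
  by (simp add: s_def det_mat_3 skew_part_swap[of M j i] skew_part_swap[of M k j]
      skew_part_swap[of M k i] power2_eq_square algebra_simps)

lemma principal_minor_4:
  assumes M: "gen_tournament n M" and ijkl: "distinct [i,j,k,l]" "set [i,j,k,l] \<subseteq> {..<n}"
  defines "s \<equiv> skew_part M"
  shows "16 * det (principal_submatrix M (set [i,j,k,l])) = (pfaffian s i j k l)\<^sup>2
    + (s i j)\<^sup>2 + (s i k)\<^sup>2 + (s i l)\<^sup>2 + (s j k)\<^sup>2 + (s j l)\<^sup>2 + (s k l)\<^sup>2
    - (s i j + s j k + s k i)\<^sup>2 - (s i j + s j l + s l i)\<^sup>2
    - (s i k + s k l + s l i)\<^sup>2 - (s j k + s k l + s l j)\<^sup>2 - 3"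
  using det_principal_submatrix_gen_tournament[OF M ijkl, of 4]
  by (simp add: s_def pfaffian_def det_mat_4 skew_part_swap[of M j i] skew_part_swap[of M k i]
      skew_part_swap[of M l i] skew_part_swap[of M k j] skew_part_swap[of M l j]
      skew_part_swap[of M l k] power2_eq_square algebra_simps)

lemma minors_agree_if_small_principal_minors_eq:
  assumes A: "gen_tournament n A" and B: "gen_tournament n B"
    and small: "\<And>X. X \<subseteq> {..<n} \<Longrightarrow> 1 \<le> card X \<Longrightarrow> card X \<le> 4 \<Longrightarrow>
      det (principal_submatrix A X) = det (principal_submatrix B X)"
  shows "minors_agree {..<n} (skew_part A) (skew_part B)"
proof -
  let ?s = "skew_part A" and ?t = "skew_part B"
  have minor: "det (principal_submatrix A (set xs)) = det (principal_submatrix B (set xs))"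
    if "set xs \<subseteq> {..<n}" "xs \<noteq> []" "length xs \<le> 4" for xs
    using small[OF that(1)] that(2,3) card_length[of xs] by (simp add: Suc_le_eq card_gt_0_iff)
  have diagonal: "skew_part M i i = 0" for M :: "real mat" and i by (simp add: skew_part_def)
  have order2: "(?s i j)\<^sup>2 = (?t i j)\<^sup>2" if "i < n" "j < n" for i j
  proof (cases "distinct [i,j]")
    case True
    then show ?thesis
      using minor[of "[i,j]"] principal_minor_2[OF A True] principal_minor_2[OF B True] that by simp
  qed (simp add: diagonal)
  have order3: "(?s i j + ?s j k + ?s k i)\<^sup>2 = (?t i j + ?t j k + ?t k i)\<^sup>2"
    if "i < n" "j < n" "k < n" for i j k
  proof (cases "distinct [i,j,k]")
    case True
    then show ?thesis
      using minor[of "[i,j,k]"] principal_minor_3[OF A True] principal_minor_3[OF B True] that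
      by (simp add: order2)
  next
    case False
    then show ?thesis by (auto simp: skew_part_def)
  qed
  have order4: "(pfaffian ?s i j k l)\<^sup>2 = (pfaffian ?t i j k l)\<^sup>2"
    if "i < n" "j < n" "k < n" "l < n" for i j k l
  proof (cases "distinct [i,j,k,l]")
    case True
    then show ?thesis
      using minor[of "[i,j,k,l]"] principal_minor_4[OF A True] principal_minor_4[OF B True] that
      by (simp add: order2 order3)
  next
    case False
    then have "pfaffian (skew_part M) i j k l = 0" for M :: "real mat"
      by (auto simp: pfaffian_def skew_part_def algebra_simps)
    then show ?thesis by simp
  qed
  show ?thesis unfolding minors_agree_def using order2 order3 order4 by simp
qed

lemma gen_tournament_Inv:
  assumes M: "gen_tournament n M"
  shows "gen_tournament n (Inv M X)"
proof -
  have "Inv M X $$ (i,j) = (if i \<in> X \<and> j \<in> X then M $$ (j,i) else M $$ (i,j))"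
    if "i < n" "j < n" for i j
    using gen_tournament_carrier[OF M] that unfolding Inv_def by auto
  moreover have "Inv M X \<in> carrier_mat n n"
    using gen_tournament_carrier[OF M] unfolding Inv_def by auto
  ultimately show ?thesis using M unfolding gen_tournament_iff by (simp add: add.commute)
qed

lemma skew_part_Inv:
  assumes "M \<in> carrier_mat n n"
  shows "agree_on {..<n} (skew_part (Inv M X)) (flip X (skew_part M))"
  using assms unfolding agree_on_def skew_part_def flip_def Inv_def by auto

lemma is_clan_if_clan_skew_part:
  assumes M: "gen_tournament n M" and X: "clan {..<n} (skew_part M) X"
  shows "is_clan n M X"
proof -
  have "M $$ (i,k) = M $$ (j,k) \<and> M $$ (k,i) = M $$ (k,j)"
    if "i \<in> X" "j \<in> X" "k \<in> {..<n} - X" for i j k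
  proof -
    have "i < n" "j < n" "k < n" "i \<noteq> k" "j \<noteq> k" using that clan_subset[OF X] by auto
    moreover have "skew_part M i k = skew_part M j k" "skew_part M k i = skew_part M k j"
      using X that unfolding clan_def by blast+
    ultimately show ?thesis using gen_tournament_entry[OF M] by simp
  qed
  then show ?thesis using clan_subset[OF X] unfolding is_clan_def by blast
qed

lemma gen_tournament_eq_if_skew_part_agree_on:
  assumes A: "gen_tournament n A" and B: "gen_tournament n B"
    and "agree_on {..<n} (skew_part A) (skew_part B)"
  shows "A = B"
proof (rule eq_matI)
  show "dim_row A = dim_row B" "dim_col A = dim_col B"
    using gen_tournament_carrier[OF A] gen_tournament_carrier[OF B] by auto
  fix i j assume "i < dim_row B" "j < dim_col B"
  then have "i < n" "j < n" using gen_tournament_carrier[OF B] by auto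
  then show "A $$ (i,j) = B $$ (i,j)"
    using gen_tournament_entry[OF A] gen_tournament_entry[OF B] assms(3)
    unfolding agree_on_def by simp
qed

definition mat_clan_inversion :: "nat \<Rightarrow> 'a mat \<Rightarrow> 'a mat \<Rightarrow> bool" where
  "mat_clan_inversion n A B \<longleftrightarrow> (\<exists>X. is_clan n A X \<and> B = Inv A X)"

lemma gen_tournament_mat_clan_inversions:
  "(mat_clan_inversion n)\<^sup>*\<^sup>* A B \<Longrightarrow> gen_tournament n A \<Longrightarrow> gen_tournament n B"
  by (induction rule: rtranclp_induct) (auto simp: mat_clan_inversion_def gen_tournament_Inv)

lemma principal_minors_mat_clan_inversions:
  assumes "(mat_clan_inversion n)\<^sup>*\<^sup>* A B" "gen_tournament n A" "Y \<subseteq> {..<n}"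
  shows "det (principal_submatrix A Y) = det (principal_submatrix B Y)"
  using assms(1)
proof (induction rule: rtranclp_induct)
  case (step B C)
  then obtain X where "is_clan n B X" "C = Inv B X" unfolding mat_clan_inversion_def by blast
  moreover have "B \<in> carrier_mat n n"
    using gen_tournament_carrier gen_tournament_mat_clan_inversions[OF step.hyps(1) assms(2)] .
  ultimately show ?case using det_principal_submatrix_Inv[of B n X Y] assms(3) step.IH by simp
qed simp

lemma mat_clan_inversions_lift:
  assumes "(clan_inversion {..<n})\<^sup>*\<^sup>* (skew_part A) t" and A: "gen_tournament n A"
  shows "\<exists>B. (mat_clan_inversion n)\<^sup>*\<^sup>* A B \<and> agree_on {..<n} (skew_part B) t"
  using assms(1)
proof (induction rule: rtranclp_induct)
  case base
  then show ?case using agree_on_refl by blast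
next
  case (step t t')
  obtain B where B: "(mat_clan_inversion n)\<^sup>*\<^sup>* A B" "agree_on {..<n} (skew_part B) t"
    using step.IH by blast
  obtain X where X: "clan {..<n} t X" "agree_on {..<n} t' (flip X t)"
    using step.hyps(2) unfolding clan_inversion_def by blast
  have tournament: "gen_tournament n B" by (rule gen_tournament_mat_clan_inversions[OF B(1) A])
  then have "is_clan n B X"
    using is_clan_if_clan_skew_part clan_agree_on[OF X(1) B(2)] by blast
  then have "mat_clan_inversion n B (Inv B X)" unfolding mat_clan_inversion_def by blast
  moreover have "agree_on {..<n} (skew_part (Inv B X)) t'"
    using skew_part_Inv[OF gen_tournament_carrier[OF tournament], of X]
      agree_on_flip[OF B(2), of X] X(2)
    unfolding agree_on_def by simp
  ultimately show ?case using B(1) by (meson rtranclp.rtrancl_into_rtrancl)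
qed

lemma mat_clan_inversions_iff_sequence:
  assumes A: "gen_tournament n A"
  shows "(mat_clan_inversion n)\<^sup>*\<^sup>* A B \<longleftrightarrow>
    (\<exists>m As Xs. As 0 = A \<and> As m = B \<and> (\<forall>k\<le>m. gen_tournament n (As k)) \<and>
      (\<forall>k<m. is_clan n (As k) (Xs k) \<and> As (Suc k) = Inv (As k) (Xs k)))" (is "_ \<longleftrightarrow> ?sequence")
proof
  assume "(mat_clan_inversion n)\<^sup>*\<^sup>* A B"
  then obtain m As where As: "As 0 = A" "As m = B"
    and steps: "\<forall>k<m. mat_clan_inversion n (As k) (As (Suc k))"
    unfolding rtranclp_power relpowp_fun_conv by blast
  obtain Xs where "\<forall>k<m. is_clan n (As k) (Xs k) \<and> As (Suc k) = Inv (As k) (Xs k)"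
    using steps unfolding mat_clan_inversion_def by metis
  moreover have "gen_tournament n (As k)" if "k \<le> m" for k
    using that
  proof (induction k)
    case (Suc k)
    then have "mat_clan_inversion n (As k) (As (Suc k))" using steps by simp
    then show ?case using Suc gen_tournament_Inv unfolding mat_clan_inversion_def by force
  qed (simp add: As A)
  ultimately show ?sequence using As by blast
next
  assume ?sequence
  then show "(mat_clan_inversion n)\<^sup>*\<^sup>* A B"
    unfolding rtranclp_power relpowp_fun_conv mat_clan_inversion_def by blast
qed

theorem theorem2p4:
  fixes n :: nat and A B :: "real mat"
  assumes "n \<ge> 1"
    and "gen_tournament n A" and "gen_tournament n B"
  shows "((\<forall>X. X \<subseteq> {..<n} \<and> 1 \<le> card X \<and> card X \<le> 4 \<longrightarrow>
              det (principal_submatrix A X) = det (principal_submatrix B X))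
          \<longleftrightarrow>
          (\<forall>X. X \<subseteq> {..<n} \<and> X \<noteq> {} \<longrightarrow>
              det (principal_submatrix A X) = det (principal_submatrix B X)))
       \<and>
         ((\<forall>X. X \<subseteq> {..<n} \<and> X \<noteq> {} \<longrightarrow>
              det (principal_submatrix A X) = det (principal_submatrix B X))
          \<longleftrightarrow>
          (\<exists>(m::nat) (As :: nat \<Rightarrow> real mat) (Xs :: nat \<Rightarrow> nat set).
              As 0 = A \<and> As m = B \<and>
              (\<forall>k\<le>m. gen_tournament n (As k)) \<and>
              (\<forall>k<m. is_clan n (As k) (Xs k) \<and> As (Suc k) = Inv (As k) (Xs k))))"
    (is "(?small \<longleftrightarrow> ?all) \<and> (?all \<longleftrightarrow> ?sequence)")
proof -
  have all_small: "?all \<Longrightarrow> ?small" by (metis card.empty not_one_le_zero)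
  have small_sequence: "?small \<Longrightarrow> ?sequence"
  proof -
    assume ?small
    then have "minors_agree {..<n} (skew_part A) (skew_part B)"
      by (intro minors_agree_if_small_principal_minors_eq[OF assms(2,3)]) blast
    then have "skew_pair {..<n} (skew_part A) (skew_part B)"
      using skew_on_skew_part by unfold_locales
    then have "(clan_inversion {..<n})\<^sup>*\<^sup>* (skew_part A) (skew_part B)"
      by (intro clan_inversions_if_skew_pair) simp
    then obtain C where C: "(mat_clan_inversion n)\<^sup>*\<^sup>* A C"
        "agree_on {..<n} (skew_part C) (skew_part B)"
      using mat_clan_inversions_lift[OF _ assms(2)] by blast
    then have "C = B"
      using gen_tournament_eq_if_skew_part_agree_on gen_tournament_mat_clan_inversions assms(2,3)
      by blast
    then show ?sequence using C(1) mat_clan_inversions_iff_sequence[OF assms(2)] by simp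
  qed
  have "?sequence \<Longrightarrow> ?all"
    using principal_minors_mat_clan_inversions[OF _ assms(2)]
      mat_clan_inversions_iff_sequence[OF assms(2)]
    by blast
  with all_small small_sequence show ?thesis by argo
qed

end
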